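(* Let $L\ge2$. Let $Y=Y(z)$ be the normalized solution of the $L\times L$ Fuchsian system $$\frac{dY}{dz}=\sum_{i=0}^{N+1}\frac{A_i}{z-u_i}\,Y$$ described in the context, with power series part $\Phi(w)$ at $z=1/w=\infty$; let ${\boldsymbol f}={}^{\mathrm T}(f_0,\dots,f_{L-1})$ be the first column of $\Phi(w)$, and let $T[0],T[1],\dots,T[L-1]$ be the matrices produced from ${\boldsymbol f}$ by the vector continued fraction algorithm described in the context, with $w=1/z$. Then the matrix $$z^{1-L}\,T[L-1]\cdots T[1]T[0]$$ is a polynomial in $z$, and it is the multiplier $R(z)$ of the Schlesinger transformation $Y\mapsto\hat Y=RY$ shifting the characteristic exponents at $z=\infty$ by $(L-1,-1,\dots,-1)$.
   Context: Fuchsian system: $A_i\in\mathbb{C}^{L\times L}$ are constant matrices, and $u_0=1,u_1,\dots,u_N,u_{N+1}=0$ are pairwise distinct points of $\mathbb{C}$; the regular singularities are these points and $u_{N+2}=\infty$. The matrix $A_{N+1}$ is upper triangular and $A_{N+2}:=-\sum_{i=0}^{N+1}A_i$ is lower triangular. The eigenvalues $\{\varepsilon_{0,j}\}_{0\le j\le L-1}$ of $A_{N+1}$ (characteristic exponents at $z=0$) have no integer differences among them, and likewise for the eigenvalues $\{\varepsilon_{\infty,j}\}$ of $A_{N+2}$ (exponents at $z=\infty$). Normalized solution: $$Y=\Psi(z)\,\mathrm{diag}(z^{\varepsilon_{0,j}})_{0\le j\le L-1}\ \text{near } z=0,\qquad Y=\Phi(w)\,\mathrm{diag}(w^{\varepsilon_{\infty,j}})_{0\le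 j\le L-1}\,C\ \text{near } w=1/z=0,$$ where $\Psi$ is holomorphic at $z=0$ with $\Psi(0)$ upper triangular with all diagonal entries $1$, $\Phi$ is holomorphic at $w=0$ with $\Phi(0)$ lower triangular and invertible, and $C$ is an invertible constant matrix. A Schlesinger transformation is a left multiplication $Y\mapsto\hat Y=RY$ by a rational function matrix $R(z)$ such that the equation $d\hat Y/dz=\hat A\hat Y$ satisfied by $\hat Y$ has the same form as the original, i.e. $\hat A=\sum_{i=0}^{N+1}\hat A_i/(z-u_i)$ with constant $\hat A_i$, $\hat A_{N+1}$ upper triangular and $-\sum_{i=0}^{N+1}\hat A_i$ lower triangular, and $\hat Y$ has local expansions $\hat Y=\hat\Psi(z)\,\mathrm{diag}(z^{\hat\varepsilon_{0,j}})_{0\le j\le L-1}$ near $z=0$ and $\hat Y=\hat\Phi(w)\,\mathrm{diag}(w^{\hat\varepsilon_{\infty,j}})_{0\le j\le L-1}\,\hat C$ near $w=1/z=0$, where $\hat\Psi$ is holomorphic at $z=0$ with $\hat\Psi(0)$ upper triangular with all diagonal entries $1$, $\hat\Phi$ is holomorphic at $w=0$ with $\hat\Phi(0)$ lower triangular and invertible, $\hat C$ is an invertible constant matrix, and $\hat\varepsilon_{0,j}$, $\hat\varepsilon_{\infty,j}$ are the new exponents (here with the exponents at $z=0$ unchanged, i.e. $\hat\varepsilon_{0,j}=\varepsilon_{0,j}$). Shifting the exponents at $\infty$ by $(\nu_0,\dots,\nu_{L-1})$ means that $\varepsilon_{\infty,j}$ is replaced by $\varepsilon_{\infty,j}+\nu_j$.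 Algorithm: put ${\boldsymbol f}[0]={\boldsymbol f}$; given ${\boldsymbol f}[k]={}^{\mathrm T}(f_0[k],\dots,f_{L-1}[k])\in\mathbb{C}^L[\![w]\!]$ with constant terms $a^i[k]=f_i[k](0)$, assumed to be all nonzero (generic condition, for every step $k$ used), let ${\boldsymbol f}[k+1]=T[k]{\boldsymbol f}[k]$, i.e. $$f_0[k+1]=f_{L-1}[k],\qquad f_i[k+1]=\frac1w\left(f_{i-1}[k]-\frac{a^{i-1}[k]}{a^i[k]}f_i[k]\right)\quad(1\le i\le L-1);$$ so $T[k]$ is the $L\times L$ matrix (rows and columns indexed by $0,\dots,L-1$) with $T[k]_{0,L-1}=1$, $T[k]_{i,i-1}=\frac1w$ and $T[k]_{i,i}=-\frac1w\frac{a^{i-1}[k]}{a^i[k]}$ for $1\le i\le L-1$, and all other entries zero. *)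

theory Defs
  imports
    "HOL-Complex_Analysis.Complex_Analysis"
    "Jordan_Normal_Form.Spectral_Radius"
begin

subsection \<open>Fuchsian systems\<close>

definition lower_triangular :: "'a::zero mat \<Rightarrow> bool" where
  "lower_triangular A \<longleftrightarrow> upper_triangular (transpose_mat A)"

definition system_matrix ::
    "nat \<Rightarrow> nat \<Rightarrow> (nat \<Rightarrow> complex) \<Rightarrow> (nat \<Rightarrow> complex mat) \<Rightarrow> complex \<Rightarrow> complex mat" where
  "system_matrix L N u A z = mat L L (\<lambda>(i, j). \<Sum>k\<le>N+1. A k $$ (i, j) / (z - u k))"

text \<open>The matrix \<open>A\<^sub>N\<^sub>+\<^sub>2\<close>.\<close>

definition residue_at_infinity :: "nat \<Rightarrow> nat \<Rightarrow> (nat \<Rightarrow> complex mat) \<Rightarrow> complex mat" where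
  "residue_at_infinity L N A = mat L L (\<lambda>(i, j). - (\<Sum>k\<le>N+1. A k $$ (i, j)))"

definition singular_points :: "nat \<Rightarrow> (nat \<Rightarrow> complex) \<Rightarrow> bool" where
  "singular_points N u \<longleftrightarrow> u 0 = 1 \<and> u (N+1) = 0 \<and> inj_on u {..N+1}"

text \<open>For pairwise distinct \<open>\<epsilon>\<^sub>j\<close> (implied by non-resonance) the first conjunct says that
  the \<open>\<epsilon>\<^sub>j\<close> are exactly the \<open>L\<close> eigenvalues of \<open>B\<close>.\<close>

definition nonresonant_exponents :: "nat \<Rightarrow> complex mat \<Rightarrow> (nat \<Rightarrow> complex) \<Rightarrow> bool" where
  "nonresonant_exponents L B \<epsilon> \<longleftrightarrow>
     spectrum B = \<epsilon> ` {..<L} \<and>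
     (\<forall>j<L. \<forall>k<L. j \<noteq> k \<longrightarrow> \<epsilon> j - \<epsilon> k \<notin> \<int>)"

definition fuchsian_system ::
    "nat \<Rightarrow> nat \<Rightarrow> (nat \<Rightarrow> complex) \<Rightarrow> (nat \<Rightarrow> complex mat) \<Rightarrow>
     (nat \<Rightarrow> complex) \<Rightarrow> (nat \<Rightarrow> complex) \<Rightarrow> bool" where
  "fuchsian_system L N u A \<epsilon>0 \<epsilon>inf \<longleftrightarrow>
     singular_points N u \<and>
     (\<forall>i\<le>N+1. A i \<in> carrier_mat L L) \<and>
     upper_triangular (A (N+1)) \<and>
     lower_triangular (residue_at_infinity L N A) \<and>
     nonresonant_exponents L (A (N+1)) \<epsilon>0 \<and>
     nonresonant_exponents L (residue_at_infinity L N A) \<epsilon>inf"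


subsection \<open>Multivalued solutions\<close>

text \<open>Solutions of the system are multivalued functions of \<open>z\<close>.  They are represented as
  single-valued functions of a point \<open>\<tau>\<close> of a universal covering, realised on a plane domain, of
  the complement of the finite singular points, with \<open>z = cov_proj X \<tau>\<close>.  The function
  \<open>cov_log X\<close> is a branch of \<open>log z\<close> on the covering, so that \<open>z\<close> to the power \<open>\<epsilon>\<close> is
  \<open>exp (\<epsilon> * cov_log X \<tau>)\<close>.  The sets \<open>cov_zero X\<close> and \<open>cov_inf X\<close> are the sheets over punctured
  neighbourhoods of \<open>0\<close> and \<open>\<infinity>\<close> on which local expansions are written; they are fixed once
  and for all, so that the expansions at \<open>0\<close> and \<open>\<infinity>\<close> are connected by analytic continuation.\<close>

record covering =
  cov_dom :: "complex set"
  cov_proj :: "complex \<Rightarrow> complex"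
  cov_log :: "complex \<Rightarrow> complex"
  cov_zero :: "complex set"
  cov_inf :: "complex set"

definition fuchsian_covering :: "nat \<Rightarrow> (nat \<Rightarrow> complex) \<Rightarrow> covering \<Rightarrow> bool" where
  "fuchsian_covering N u X \<longleftrightarrow>
     open (cov_dom X) \<and> simply_connected (cov_dom X) \<and>
     cov_proj X holomorphic_on cov_dom X \<and>
     covering_space (cov_dom X) (cov_proj X) (- (u ` {..N+1})) \<and>
     cov_log X holomorphic_on cov_dom X \<and>
     (\<forall>\<tau>\<in>cov_dom X. exp (cov_log X \<tau>) = cov_proj X \<tau>) \<and>
     (\<exists>r>0. (\<forall>i\<le>N. r \<le> norm (u i)) \<and>
        cov_zero X \<in> components {\<tau> \<in> cov_dom X. norm (cov_proj X \<tau>) < r}) \<and>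
     (\<exists>r>0. (\<forall>i\<le>N. norm (u i) \<le> r) \<and>
        cov_inf X \<in> components {\<tau> \<in> cov_dom X. r < norm (cov_proj X \<tau>)})"

text \<open>\<open>dY/dz = A(z) Y\<close>, written with respect to the coordinate \<open>\<tau>\<close> by the chain rule.\<close>

definition solves_system ::
    "nat \<Rightarrow> nat \<Rightarrow> (nat \<Rightarrow> complex) \<Rightarrow> covering \<Rightarrow> (nat \<Rightarrow> complex mat) \<Rightarrow>
     (complex \<Rightarrow> complex mat) \<Rightarrow> bool" where
  "solves_system L N u X A Y \<longleftrightarrow>
     (\<forall>\<tau>\<in>cov_dom X. Y \<tau> \<in> carrier_mat L L \<and>
       (\<forall>i<L. \<forall>j<L.
         ((\<lambda>t. Y t $$ (i, j)) has_field_derivative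
            deriv (cov_proj X) \<tau> * (system_matrix L N u A (cov_proj X \<tau>) * Y \<tau>) $$ (i, j))
         (at \<tau>)))"

definition analytic_mat_at_0 :: "nat \<Rightarrow> (complex \<Rightarrow> complex mat) \<Rightarrow> bool" where
  "analytic_mat_at_0 L F \<longleftrightarrow>
     (\<forall>x. F x \<in> carrier_mat L L) \<and>
     (\<forall>i<L. \<forall>j<L. (\<lambda>x. F x $$ (i, j)) analytic_on {0})"

definition expansion_at_zero ::
    "nat \<Rightarrow> covering \<Rightarrow> (nat \<Rightarrow> complex) \<Rightarrow> (complex \<Rightarrow> complex mat) \<Rightarrow>
     (complex \<Rightarrow> complex mat) \<Rightarrow> bool" where
  "expansion_at_zero L X \<epsilon>0 Y \<Psi> \<longleftrightarrow>
     analytic_mat_at_0 L \<Psi> \<and>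
     upper_triangular (\<Psi> 0) \<and> (\<forall>j<L. \<Psi> 0 $$ (j, j) = 1) \<and>
     (\<exists>r>0. \<forall>\<tau>\<in>cov_zero X. norm (cov_proj X \<tau>) < r \<longrightarrow>
        Y \<tau> = \<Psi> (cov_proj X \<tau>) * mat_diag L (\<lambda>j. exp (\<epsilon>0 j * cov_log X \<tau>)))"

text \<open>Here \<open>w = 1 / z\<close> and \<open>log w = - log z\<close>.\<close>

definition expansion_at_infinity ::
    "nat \<Rightarrow> covering \<Rightarrow> (nat \<Rightarrow> complex) \<Rightarrow> (complex \<Rightarrow> complex mat) \<Rightarrow>
     (complex \<Rightarrow> complex mat) \<Rightarrow> complex mat \<Rightarrow> bool" where
  "expansion_at_infinity L X \<epsilon>inf Y \<Phi> C \<longleftrightarrow>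
     analytic_mat_at_0 L \<Phi> \<and>
     lower_triangular (\<Phi> 0) \<and> invertible_mat (\<Phi> 0) \<and>
     C \<in> carrier_mat L L \<and> invertible_mat C \<and>
     (\<exists>r>0. \<forall>\<tau>\<in>cov_inf X. norm (1 / cov_proj X \<tau>) < r \<longrightarrow>
        Y \<tau> = \<Phi> (1 / cov_proj X \<tau>) * mat_diag L (\<lambda>j. exp (\<epsilon>inf j * (- cov_log X \<tau>))) * C)"

definition normalized_solution ::
    "nat \<Rightarrow> nat \<Rightarrow> (nat \<Rightarrow> complex) \<Rightarrow> covering \<Rightarrow> (nat \<Rightarrow> complex mat) \<Rightarrow>
     (nat \<Rightarrow> complex) \<Rightarrow> (nat \<Rightarrow> complex) \<Rightarrow> (complex \<Rightarrow> complex mat) \<Rightarrow>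
     (complex \<Rightarrow> complex mat) \<Rightarrow> (complex \<Rightarrow> complex mat) \<Rightarrow> complex mat \<Rightarrow> bool" where
  "normalized_solution L N u X A \<epsilon>0 \<epsilon>inf Y \<Psi> \<Phi> C \<longleftrightarrow>
     fuchsian_system L N u A \<epsilon>0 \<epsilon>inf \<and>
     solves_system L N u X A Y \<and>
     expansion_at_zero L X \<epsilon>0 Y \<Psi> \<and>
     expansion_at_infinity L X \<epsilon>inf Y \<Phi> C"


subsection \<open>Schlesinger transformations\<close>

text \<open>Values at the zeros of the denominator are irrelevant.\<close>

definition rational_matrix :: "nat \<Rightarrow> (complex \<Rightarrow> complex mat) \<Rightarrow> bool" where
  "rational_matrix L R \<longleftrightarrow>
     (\<forall>z. R z \<in> carrier_mat L L) \<and>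
     (\<forall>i<L. \<forall>j<L. \<exists>p q. q \<noteq> 0 \<and>
        (\<forall>z. poly q z \<noteq> 0 \<longrightarrow> R z $$ (i, j) = poly p z / poly q z))"

text \<open>\<open>R\<close> is the multiplier of a Schlesinger transformation of \<open>Y\<close> that keeps the exponents at
  \<open>0\<close> and shifts the exponents at \<open>\<infinity>\<close> by \<open>\<nu>\<close>.\<close>

definition schlesinger_multiplier ::
    "nat \<Rightarrow> nat \<Rightarrow> (nat \<Rightarrow> complex) \<Rightarrow> covering \<Rightarrow> (nat \<Rightarrow> complex) \<Rightarrow> (nat \<Rightarrow> complex) \<Rightarrow>
     (complex \<Rightarrow> complex mat) \<Rightarrow> (nat \<Rightarrow> int) \<Rightarrow> (complex \<Rightarrow> complex mat) \<Rightarrow> bool" where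
  "schlesinger_multiplier L N u X \<epsilon>0 \<epsilon>inf Y \<nu> R \<longleftrightarrow>
     rational_matrix L R \<and>
     (\<exists>A' \<Psi>' \<Phi>' C'.
        normalized_solution L N u X A' \<epsilon>0 (\<lambda>j. \<epsilon>inf j + of_int (\<nu> j))
          (\<lambda>\<tau>. R (cov_proj X \<tau>) * Y \<tau>) \<Psi>' \<Phi>' C')"


subsection \<open>The vector continued fraction algorithm\<close>

text \<open>Only the components \<open>f i\<close> with \<open>i < L\<close> are meaningful.  The division by \<open>fps_X\<close> (that is,
  by \<open>w\<close>) is exact as soon as the constant term of \<open>f i\<close> is nonzero.\<close>

definition vcf_step :: "nat \<Rightarrow> (nat \<Rightarrow> complex fps) \<Rightarrow> nat \<Rightarrow> complex fps" where
  "vcf_step L f i =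
     (if i = 0 then f (L - 1)
      else (f (i - 1) - fps_const (fps_nth (f (i - 1)) 0 / fps_nth (f i) 0) * f i) / fps_X)"

definition vcf :: "nat \<Rightarrow> (nat \<Rightarrow> complex fps) \<Rightarrow> nat \<Rightarrow> nat \<Rightarrow> complex fps" where
  "vcf L f k = (vcf_step L ^^ k) f"

text \<open>The matrix \<open>T[k]\<close> at the point \<open>w\<close>.\<close>

definition vcf_matrix :: "nat \<Rightarrow> (nat \<Rightarrow> complex fps) \<Rightarrow> nat \<Rightarrow> complex \<Rightarrow> complex mat" where
  "vcf_matrix L f k w = mat L L (\<lambda>(i, j).
     if i = 0 then (if j = L - 1 then 1 else 0)
     else if j = i - 1 then 1 / w
     else if j = i then - (1 / w) * (fps_nth (vcf L f k (i - 1)) 0 / fps_nth (vcf L f k i) 0)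
     else 0)"

text \<open>\<open>vcf_product L f n w\<close> is \<open>T[n-1] \<dots> T[1] T[0]\<close> at the point \<open>w\<close>.\<close>

primrec vcf_product :: "nat \<Rightarrow> (nat \<Rightarrow> complex fps) \<Rightarrow> nat \<Rightarrow> complex \<Rightarrow> complex mat" where
  "vcf_product L f 0 w = 1\<^sub>m L"
| "vcf_product L f (Suc n) w = vcf_matrix L f n w * vcf_product L f n w"

definition vcf_multiplier :: "nat \<Rightarrow> (nat \<Rightarrow> complex fps) \<Rightarrow> complex \<Rightarrow> complex mat" where
  "vcf_multiplier L f z = (z powi (1 - int L)) \<cdot>\<^sub>m vcf_product L f L (1 / z)"

end

theory Submission
  imports Defs
begin

text \<open>The product \<open>z\<^sup>1\<^sup>-\<^sup>L T[L-1] \<dots> T[0]\<close> has the form \<open>R(z) = B\<^sub>0 + z B\<^sub>1\<close> with \<open>B\<^sub>0\<close> upper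
  unitriangular and \<open>B\<^sub>1\<close> lower triangular, so \<open>R\<close> preserves the normalisation at \<open>0\<close>.  Because
  \<open>T[L-1] \<dots> T[0]\<close> maps the first column of \<open>\<Phi>\<close> to a power series, the shifted expansion at
  infinity is regular, and comparing determinants there gives \<open>det R = 1\<close>.  Hence \<open>R\<^sup>-\<^sup>1\<close> is a
  polynomial too, the coefficient matrix of \<open>R Y\<close> acquires no new poles, and its behaviour at
  infinity is read off from the shifted expansion.\<close>

subsection \<open>Matrices\<close>

text \<open>A polynomial inverse is what excludes apparent singularities: \<open>R' R^-1\<close> is
  then polynomial, and conjugating \<open>A k / (z - u k)\<close> leaves a simple pole whose residue
  is explicit, namely \<open>A k\<close> conjugated by \<open>R(u k)\<close>. At \<open>0\<close>
  this is conjugation by \<open>B0\<close>, which keeps triangularity and spectrum. At infinity no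
  such formula is available, because \<open>R\<close> is not regular there; the residue is instead
  recovered from the logarithmic derivative of the new expansion, as the diagonal matrix of new
  exponents conjugated by the leading coefficient of that expansion. The shifts add up to
  \<open>(L-1) - (L-1) = 0\<close>, which is what allows the determinant of \<open>R\<close> to be
  constant. The obstacle is multivaluedness: the expansion at infinity is an identity on one sheet
  of a covering, whereas the limits needed are limits in \<open>z\<close>. They are reached by
  choosing, over each \<open>z\<close> of large modulus, a point of that sheet.\<close>

lemma index_mult_mat_sum:
  assumes "A \<in> carrier_mat n n" "B \<in> carrier_mat n n" "i < n" "j < n"
  shows "(A * B) $$ (i, j) = (\<Sum>k<n. A $$ (i, k) * B $$ (k, j))"
  using assms by (auto simp: scalar_prod_def lessThan_atLeast0 intro!: sum.cong)

section \<open>Products and inverses of triangular matrices\<close>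

lemma upper_triangular_mult:
  fixes A B :: "'a::semiring_0 mat"
  assumes "A \<in> carrier_mat n n" "B \<in> carrier_mat n n"
    and A: "upper_triangular A" and B: "upper_triangular B"
  shows "upper_triangular (A * B)"
proof (rule upper_triangularI)
  fix i j assume *: "j < i" "i < dim_row (A * B)"
  hence "(A * B) $$ (i, j) = (\<Sum>k<n. A $$ (i, k) * B $$ (k, j))"
    using assms by (intro index_mult_mat_sum) auto
  also have "\<dots> = 0"
  proof (rule sum.neutral, rule ballI)
    fix k assume "k \<in> {..<n}"
    thus "A $$ (i, k) * B $$ (k, j) = 0"
      using * assms upper_triangularD[OF A, of k i] upper_triangularD[OF B, of j k]
      by (cases "k < i") auto
  qed
  finally show "(A * B) $$ (i, j) = 0" .
qed

text \<open>Serves the normalisation at \<open>0\<close>: the unit diagonals of \<open>B0\<close>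
  and \<open>\<Psi> 0\<close> give that of their product.\<close>

lemma upper_triangular_mult_diag:
  fixes A B :: "'a::semiring_0 mat"
  assumes "A \<in> carrier_mat n n" "B \<in> carrier_mat n n"
    and A: "upper_triangular A" and B: "upper_triangular B" and "i < n"
  shows "(A * B) $$ (i, i) = A $$ (i, i) * B $$ (i, i)"
proof -
  have "(A * B) $$ (i, i) = (\<Sum>k<n. A $$ (i, k) * B $$ (k, i))"
    using assms by (intro index_mult_mat_sum) auto
  also have "\<dots> = (\<Sum>k\<in>{i}. A $$ (i, k) * B $$ (k, i))"
  proof (rule sum.mono_neutral_right)
    show "\<forall>k\<in>{..<n} - {i}. A $$ (i, k) * B $$ (k, i) = 0"
    proof
      fix k assume "k \<in> {..<n} - {i}"
      thus "A $$ (i, k) * B $$ (k, i) = 0"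
        using assms upper_triangularD[OF A, of k i] upper_triangularD[OF B, of i k]
        by (cases "k < i") auto
    qed
  qed (use assms in auto)
  finally show ?thesis by simp
qed

text \<open>Induction on the column: in the entry \<open>(i, j)\<close> of \<open>B * A = 1\<close>
  with \<open>j < i\<close>, the terms \<open>k < j\<close> vanish by induction and the terms
  \<open>k > j\<close> by triangularity of \<open>A\<close>. What is left is
  \<open>B_ij A_jj = 0\<close>, and the diagonal of \<open>A\<close> is nonzero because its
  determinant is.\<close>

lemma upper_triangular_inverse:
  fixes A B :: "'a::field mat"
  assumes A: "A \<in> carrier_mat n n" and B: "B \<in> carrier_mat n n"
    and ut: "upper_triangular A" and inv: "B * A = 1\<^sub>m n"
  shows "upper_triangular B"
proof -
  have "Determinant.det B * Determinant.det A = 1"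
    using det_mult[OF B A] inv by simp
  hence "0 \<notin> set (diag_mat A)"
    using upper_triangular_imp_det_eq_0_iff[OF A ut] by auto
  hence diag: "A $$ (j, j) \<noteq> 0" if "j < n" for j
    using that A by (auto simp: diag_mat_def)
  have "B $$ (i, j) = 0" if "j < i" "i < n" for i j
    using that
  proof (induction j rule: less_induct)
    case (less j)
    have "0 = (B * A) $$ (i, j)" using inv less.prems by simp
    also have "\<dots> = (\<Sum>k<n. B $$ (i, k) * A $$ (k, j))"
      using A B less.prems by (intro index_mult_mat_sum) auto
    also have "\<dots> = (\<Sum>k\<in>{j}. B $$ (i, k) * A $$ (k, j))"
    proof (rule sum.mono_neutral_right)
      show "\<forall>k\<in>{..<n} - {j}. B $$ (i, k) * A $$ (k, j) = 0"
      proof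
        fix k assume "k \<in> {..<n} - {j}"
        thus "B $$ (i, k) * A $$ (k, j) = 0"
          using less A upper_triangularD[OF ut, of j k] by (cases "k < j") auto
      qed
    qed (use less.prems in auto)
    finally show ?case using diag[of j] less.prems by simp
  qed
  thus ?thesis using B by (auto intro: upper_triangularI)
qed

lemma lower_triangular_mult:
  fixes A B :: "'a::comm_semiring_0 mat"
  assumes "A \<in> carrier_mat n n" "B \<in> carrier_mat n n"
    and "lower_triangular A" "lower_triangular B"
  shows "lower_triangular (A * B)"
  using assms upper_triangular_mult[of "transpose_mat B" n "transpose_mat A"]
  by (simp add: lower_triangular_def transpose_mult)

text \<open>Transposition reverses products, so the inverse that stands on the left in
  \<open>upper_triangular_inverse\<close> stands on the right here.\<close>

lemma lower_triangular_inverse: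
  fixes A B :: "'a::field mat"
  assumes "A \<in> carrier_mat n n" "B \<in> carrier_mat n n"
    and "lower_triangular A" "A * B = 1\<^sub>m n"
  shows "lower_triangular B"
  using assms upper_triangular_inverse[of "transpose_mat A" n "transpose_mat B"]
  by (simp add: lower_triangular_def flip: transpose_mult)

section \<open>Spectra of similar and of diagonal matrices\<close>

lemma spectrum_similar:
  fixes A B :: "'a::field mat"
  assumes "A \<in> carrier_mat n n" "B \<in> carrier_mat n n" "similar_mat A B"
  shows "spectrum A = spectrum B"
  using assms by (simp add: spectrum_root_char_poly char_poly_similar)

lemma spectrum_mat_diag:
  "spectrum (mat_diag n d :: 'a::field mat) = d ` {..<n}"
proof -
  have ut: "upper_triangular (mat_diag n d)"
    by (auto simp: mat_diag_def upper_triangular_def)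
  have "diag_mat (mat_diag n d) = map d [0..<n]"
    by (auto simp: diag_mat_def mat_diag_def)
  hence "char_poly (mat_diag n d) = (\<Prod>a\<leftarrow>map d [0..<n]. [:- a, 1:])"
    using char_poly_upper_triangular[OF mat_diag_dim ut] by simp
  thus ?thesis
    by (auto simp: spectrum_root_char_poly[of _ n] poly_prod_list prod_list_zero_iff image_iff)
qed

lemma similar_mat_conjugate:
  assumes "P \<in> carrier_mat n n" "Q \<in> carrier_mat n n" "B \<in> carrier_mat n n"
    and "P * Q = 1\<^sub>m n" "Q * P = 1\<^sub>m n"
  shows "similar_mat (P * B * Q) B"
  using assms by (intro similar_matI[of _ _ P Q n]) auto

text \<open>\<open>invertible_mat\<close> does not fix the dimensions of the inverse. They are
  forced by \<open>A * B\<close> being the identity of size \<open>n\<close> and by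
  \<open>B * A\<close> having as many columns as \<open>A\<close>.\<close>

lemma invertible_mat_right_inverse:
  fixes A :: "'a::field mat"
  assumes "A \<in> carrier_mat n n" "invertible_mat A"
  obtains B where "B \<in> carrier_mat n n" "A * B = 1\<^sub>m n"
proof -
  from assms obtain B where B: "A * B = 1\<^sub>m n" "B * A = 1\<^sub>m (dim_row B)"
    by (auto simp: invertible_mat_def inverts_mat_def)
  hence "dim_col B = n" "dim_row B = n" using assms
    by (metis index_mult_mat(3) index_one_mat(3), metis assms(1) B carrier_matD(2) index_mult_mat(3) index_one_mat(3))
  with B show ?thesis by (intro that[of B]) auto
qed

lemma invertible_mat_det_nonzero:
  fixes A :: "'a::field mat"
  assumes "A \<in> carrier_mat n n" "invertible_mat A"
  shows "Determinant.det A \<noteq> 0"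
proof -
  obtain B where "B \<in> carrier_mat n n" "A * B = 1\<^sub>m n"
    using invertible_mat_right_inverse[OF assms] .
  thus ?thesis using det_mult[OF assms(1), of B] by auto
qed

section \<open>Entrywise limits of products, determinants and inverses\<close>

lemma tendsto_mult_mat:
  fixes A B :: "'b \<Rightarrow> 'a::real_normed_field mat"
  assumes "\<And>x. A x \<in> carrier_mat n n" "\<And>x. B x \<in> carrier_mat n n"
    and "A0 \<in> carrier_mat n n" "B0 \<in> carrier_mat n n"
    and "\<And>i j. i < n \<Longrightarrow> j < n \<Longrightarrow> ((\<lambda>x. A x $$ (i, j)) \<longlongrightarrow> A0 $$ (i, j)) F"
    and "\<And>i j. i < n \<Longrightarrow> j < n \<Longrightarrow> ((\<lambda>x. B x $$ (i, j)) \<longlongrightarrow> B0 $$ (i, j)) F"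
    and "i < n" "j < n"
  shows "((\<lambda>x. (A x * B x) $$ (i, j)) \<longlongrightarrow> (A0 * B0) $$ (i, j)) F"
proof -
  have "((\<lambda>x. \<Sum>k<n. A x $$ (i, k) * B x $$ (k, j)) \<longlongrightarrow>
          (\<Sum>k<n. A0 $$ (i, k) * B0 $$ (k, j))) F"
    using assms by (intro tendsto_intros) auto
  thus ?thesis
    using assms(1-4,7,8) by (simp add: index_mult_mat_sum[where n = n] del: index_mult_mat)
qed

text \<open>By the Leibniz formula the determinant is a polynomial in the entries.\<close>

lemma tendsto_det:
  fixes A :: "'b \<Rightarrow> 'a::real_normed_field mat"
  assumes "\<And>x. A x \<in> carrier_mat n n" "A0 \<in> carrier_mat n n"
    and "\<And>i j. i < n \<Longrightarrow> j < n \<Longrightarrow> ((\<lambda>x. A x $$ (i, j)) \<longlongrightarrow> A0 $$ (i, j)) F"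
  shows "((\<lambda>x. Determinant.det (A x)) \<longlongrightarrow> Determinant.det A0) F"
proof -
  have "((\<lambda>x. \<Sum>p | p permutes {0..<n}. signof p * (\<Prod>i = 0..<n. A x $$ (i, p i))) \<longlongrightarrow>
         (\<Sum>p | p permutes {0..<n}. signof p * (\<Prod>i = 0..<n. A0 $$ (i, p i)))) F"
    using assms(3) by (intro tendsto_intros) (auto dest: permutes_in_image)
  thus ?thesis
    by (simp only: det_def'[OF assms(1)] det_def'[OF assms(2)])
qed

lemma tendsto_adj_mat:
  fixes A :: "'b \<Rightarrow> 'a::real_normed_field mat"
  assumes A: "\<And>x. A x \<in> carrier_mat n n" "A0 \<in> carrier_mat n n"
    and lim: "\<And>i j. i < n \<Longrightarrow> j < n \<Longrightarrow> ((\<lambda>x. A x $$ (i, j)) \<longlongrightarrow> A0 $$ (i, j)) F"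
    and "i < n" "j < n"
  shows "((\<lambda>x. adj_mat (A x) $$ (i, j)) \<longlongrightarrow> adj_mat A0 $$ (i, j)) F"
proof -
  have "((\<lambda>x. Determinant.det (mat_delete (A x) j i)) \<longlongrightarrow> Determinant.det (mat_delete A0 j i)) F"
  proof (rule tendsto_det)
    fix i' j' assume "i' < n - 1" "j' < n - 1"
    thus "((\<lambda>x. mat_delete (A x) j i $$ (i', j')) \<longlongrightarrow> mat_delete A0 j i $$ (i', j')) F"
      by (auto simp: mat_delete_def carrier_matD[OF A(1)] carrier_matD[OF A(2)] intro!: lim)
  qed (rule mat_delete_carrier[OF A(1)], rule mat_delete_carrier[OF A(2)])
  hence "((\<lambda>x. cofactor (A x) j i) \<longlongrightarrow> cofactor A0 j i) F"
    unfolding cofactor_def by (intro tendsto_intros)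
  thus ?thesis
    using assms(4,5)
    by (simp add: adj_mat_def carrier_matD[OF A(1)] carrier_matD[OF A(2)])
qed

text \<open>The adjugate gives the inverse as a rational expression in the entries, so that
  continuity follows from that of determinants. It is total: a singular matrix is sent to the zero
  matrix of the same size, which keeps families of inverses in \<open>carrier_mat n n\<close> at
  every point.\<close>

definition adj_inverse :: "'a::field mat \<Rightarrow> 'a mat" where
  "adj_inverse A = (1 / Determinant.det A) \<cdot>\<^sub>m adj_mat A"

lemma adj_inverse_carrier:
  "A \<in> carrier_mat n n \<Longrightarrow> adj_inverse A \<in> carrier_mat n n"
  using adj_mat(1)[of A n] by (simp add: adj_inverse_def)

lemma adj_inverse:
  assumes A: "A \<in> carrier_mat n n" and "Determinant.det A \<noteq> 0"
  shows "A * adj_inverse A = 1\<^sub>m n" "adj_inverse A * A = 1\<^sub>m n"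
  using assms adj_mat[OF A] mult_smult_distrib[OF A adj_mat(1)[OF A]]
    mult_smult_assoc_mat[OF adj_mat(1)[OF A] A]
  by (auto simp: adj_inverse_def intro!: eq_matI)

lemma tendsto_adj_inverse:
  fixes A :: "'b \<Rightarrow> 'a::real_normed_field mat"
  assumes A: "\<And>x. A x \<in> carrier_mat n n" "A0 \<in> carrier_mat n n"
    and lim: "\<And>i j. i < n \<Longrightarrow> j < n \<Longrightarrow> ((\<lambda>x. A x $$ (i, j)) \<longlongrightarrow> A0 $$ (i, j)) F"
    and det: "Determinant.det A0 \<noteq> 0" and ij: "i < n" "j < n"
  shows "((\<lambda>x. adj_inverse (A x) $$ (i, j)) \<longlongrightarrow> adj_inverse A0 $$ (i, j)) F"
proof -
  have "((\<lambda>x. 1 / Determinant.det (A x) * adj_mat (A x) $$ (i, j)) \<longlongrightarrow>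
          1 / Determinant.det A0 * adj_mat A0 $$ (i, j)) F"
    by (intro tendsto_intros tendsto_det[OF A lim] tendsto_adj_mat[OF A lim] det ij)
  thus ?thesis
    using ij carrier_matD[OF adj_mat(1)[OF A(2)]] carrier_matD[OF adj_mat(1)[OF A(1)]]
    by (simp add: adj_inverse_def)
qed

subsection \<open>The vector continued fraction algorithm\<close>

lemma vcf_matrix_carrier [simp]: "vcf_matrix L f k w \<in> carrier_mat L L"
  by (simp add: vcf_matrix_def)

lemma vcf_product_carrier [simp]: "vcf_product L f n w \<in> carrier_mat L L"
  by (induction n) (auto intro: mult_carrier_mat[OF vcf_matrix_carrier])

text \<open>Stated for an arbitrary \<open>v\<close>, because \<open>T[k]\<close> acts below both on
  columns of the matrix product and on vectors of function values.\<close>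

lemma vcf_matrix_apply:
  fixes f :: "nat \<Rightarrow> complex fps" and k :: nat
  assumes "i < L"
  defines "c \<equiv> fps_nth (vcf L f k (i - 1)) 0 / fps_nth (vcf L f k i) 0"
  shows "(\<Sum>m<L. vcf_matrix L f k w $$ (i, m) * v m) =
     (if i = 0 then v (L - 1) else (v (i - 1) - c * v i) / w)"
proof (cases "i = 0")
  case True
  have "(\<Sum>m<L. vcf_matrix L f k w $$ (i, m) * v m) = (\<Sum>m<L. if m = L - 1 then v m else 0)"
    using assms(1) True by (intro sum.cong) (auto simp: vcf_matrix_def)
  thus ?thesis using assms(1) True by simp
next
  case False
  have "(\<Sum>m<L. vcf_matrix L f k w $$ (i, m) * v m) =
      (\<Sum>m<L. (if m = i - 1 then v m / w else 0) + (if m = i then - c * v m / w else 0))"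
    using assms(1) False by (intro sum.cong) (auto simp: vcf_matrix_def c_def)
  also have "\<dots> = v (i - 1) / w - c * v i / w"
    using assms(1) by (simp add: sum.distrib)
  finally show ?thesis using False by (simp add: diff_divide_distrib)
qed

text \<open>Expanding an entry of the product along paths of row indices, the factor \<open>1\<close> in the corner
  of \<open>T[k]\<close> can be used at most once in \<open>n \<le> L\<close> steps; every other factor contributes a power
  of \<open>z\<close>.  Both sides carry an extra \<open>z\<close> to avoid the exponent \<open>n - 1\<close>.\<close>

lemma vcf_product_two_terms:
  assumes "n \<le> L"
  shows "\<exists>a b :: nat \<Rightarrow> nat \<Rightarrow> complex. \<forall>i<L. \<forall>j<L.
     (\<forall>z. z \<noteq> 0 \<longrightarrow>
        z * vcf_product L f n (1 / z) $$ (i, j) = z ^ Suc n * a i j + z ^ n * b i j) \<and>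
     (i < j \<or> j + n < i \<longrightarrow> a i j = 0) \<and> (j + n = i \<longrightarrow> a i j = 1) \<and>
     (j + n < i + L \<longrightarrow> b i j = 0) \<and> (j + n = i + L \<longrightarrow> b i j = 1)"
  using assms
proof (induction n)
  case 0
  show ?case
    by (intro exI[of _ "\<lambda>i j. if i = j then 1 else 0"] exI[of _ "\<lambda>_ _. 0"]) auto
next
  case (Suc n)
  note Suc.IH[OF Suc_leD[OF Suc.prems]]
  then obtain a b where IH: "\<forall>i<L. \<forall>j<L.
     (\<forall>z. z \<noteq> 0 \<longrightarrow>
        z * vcf_product L f n (1 / z) $$ (i, j) = z ^ Suc n * a i j + z ^ n * b i j) \<and>
     (i < j \<or> j + n < i \<longrightarrow> a i j = 0) \<and> (j + n = i \<longrightarrow> a i j = 1) \<and>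
     (j + n < i + L \<longrightarrow> b i j = 0) \<and> (j + n = i + L \<longrightarrow> b i j = 1)"
    by (elim exE)
  have M: "z * vcf_product L f n (1 / z) $$ (i, j) = z ^ Suc n * a i j + z ^ n * b i j"
      if "i < L" "j < L" "z \<noteq> 0" for i j z
    using IH that by blast
  have a0: "a i j = 0" if "i < L" "j < L" "i < j \<or> j + n < i" for i j
    using IH that by blast
  have a1: "a i j = 1" if "i < L" "j < L" "j + n = i" for i j
    using IH that by blast
  have b0: "b i j = 0" if "i < L" "j < L" "j + n < i + L" for i j
    using IH that by blast
  have b1: "b i j = 1" if "i < L" "j < L" "j + n = i + L" for i j
    using IH that by blast
  define c where "c i = fps_nth (vcf L f n (i - 1)) 0 / fps_nth (vcf L f n i) 0" for i
  define a' where "a' i j = (if i = 0 then 0 else a (i - 1) j - c i * a i j)" for i j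
  define b' where "b' i j = (if i = 0 then a (L - 1) j else b (i - 1) j - c i * b i j)" for i j
  \<comment> \<open>Rows \<open>i > 0\<close> gain a factor \<open>z\<close>, which raises both
    exponents by one. Row \<open>0\<close> copies the old last row without that factor, so the old
    \<open>a\<close>-term \<open>z ^ Suc n\<close> already has the exponent of the new
    \<open>b\<close>-term; hence \<open>b' 0 j = a (L - 1) j\<close>.\<close>
  have step: "z * vcf_product L f (Suc n) (1 / z) $$ (i, j) =
      z ^ Suc (Suc n) * a' i j + z ^ Suc n * b' i j"
    if ij: "i < L" "j < L" and z: "z \<noteq> 0" for i j z
  proof -
    let ?M = "\<lambda>i. vcf_product L f n (1 / z) $$ (i, j)"
    have "vcf_product L f (Suc n) (1 / z) $$ (i, j) =
        (\<Sum>m<L. vcf_matrix L f n (1 / z) $$ (i, m) * ?M m)"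
      using ij by (simp add: index_mult_mat_sum[where n = L] del: index_mult_mat)
    also have "\<dots> = (if i = 0 then ?M (L - 1) else (?M (i - 1) - c i * ?M i) / (1 / z))"
      using ij(1) by (simp only: vcf_matrix_apply c_def)
    finally have eq: "z * vcf_product L f (Suc n) (1 / z) $$ (i, j) =
        (if i = 0 then z * ?M (L - 1) else z * (z * ?M (i - 1)) - z * (c i * (z * ?M i)))"
      by (simp add: algebra_simps)
    show ?thesis
    proof (cases "i = 0")
      case True
      \<comment> \<open>A second passage through the corner is impossible: \<open>j\<close> and
        \<open>n\<close> are at most \<open>L - 1\<close>, hence \<open>j + n < (L - 1) + L\<close>.
        This is where the bound on the number of steps enters.\<close>
      have "b (L - 1) j = 0" using ij Suc.prems by (intro b0) auto
      thus ?thesis using True eq ij z M[of "L - 1" j z] by (simp add: a'_def b'_def)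
    next
      case False
      thus ?thesis using eq ij z M[of "i - 1" j z] M[of i j z]
        by (simp add: a'_def b'_def algebra_simps)
    qed
  qed
  have "a' i j = 0" if "i < L" "j < L" "i < j \<or> j + Suc n < i" for i j
    using that by (cases i) (auto simp: a'_def a0)
  moreover have "a' i j = 1" if "i < L" "j < L" "j + Suc n = i" for i j
    using that a1[of "i - 1" j] a0[of i j] by (auto simp: a'_def)
  moreover have "b' i j = 0" if "i < L" "j < L" "j + Suc n < i + L" for i j
    
  proof (cases i)
    case 0
    hence "j + n < L - 1" using that by linarith
    thus ?thesis using 0 that a0[of "L - 1" j] by (simp add: b'_def)
  qed (use that in \<open>auto simp: b'_def b0\<close>)
  moreover have "b' i j = 1" if "i < L" "j < L" "j + Suc n = i + L" for i j
    using that by (cases i) (auto simp: b'_def a1 b0 b1)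
  ultimately show ?case using step by (intro exI[of _ a'] exI[of _ b']) auto
qed

text \<open>At \<open>n = L\<close> the index conditions of \<open>vcf_product_two_terms\<close>
  meet at the diagonal: \<open>a\<close> vanishes above it, \<open>b\<close> vanishes below it and
  is \<open>1\<close> on it. Division by \<open>z ^ L\<close> turns the two terms into
  \<open>z a + b\<close>. The point \<open>z = 0\<close> is excluded, since \<open>1 / z\<close> is
  a default value there.\<close>

lemma vcf_multiplier_affine:
  assumes "L > 0"
  obtains B0 B1 :: "complex mat" where
    "B0 \<in> carrier_mat L L" "B1 \<in> carrier_mat L L"
    "upper_triangular B0" "\<And>i. i < L \<Longrightarrow> B0 $$ (i, i) = 1" "lower_triangular B1"
    "\<And>z. z \<noteq> 0 \<Longrightarrow> vcf_multiplier L f z = B0 + z \<cdot>\<^sub>m B1"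
proof -
  obtain a b :: "nat \<Rightarrow> nat \<Rightarrow> complex" where
    M: "\<And>i j z. i < L \<Longrightarrow> j < L \<Longrightarrow> z \<noteq> 0 \<Longrightarrow>
        z * vcf_product L f L (1 / z) $$ (i, j) = z ^ Suc L * a i j + z ^ L * b i j" and
    a: "\<And>i j. i < L \<Longrightarrow> j < L \<Longrightarrow> i < j \<Longrightarrow> a i j = 0" and
    b: "\<And>i j. i < L \<Longrightarrow> j < L \<Longrightarrow> j < i \<Longrightarrow> b i j = 0" "\<And>i. i < L \<Longrightarrow> b i i = 1"
    using vcf_product_two_terms[of L L f] by auto
  have "z powi (1 - int L) * vcf_product L f L (1 / z) $$ (i, j) = b i j + z * a i j"
    if "i < L" "j < L" "z \<noteq> 0" for i j z
  proof -
    have "z powi (1 - int L) * vcf_product L f L (1 / z) $$ (i, j) =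
        (z * vcf_product L f L (1 / z) $$ (i, j)) / z ^ L"
      using \<open>z \<noteq> 0\<close> by (simp add: power_int_diff)
    also have "\<dots> = b i j + z * a i j"
      using that by (simp add: M field_simps)
    finally show ?thesis .
  qed
  thus ?thesis
    using carrier_matD[OF vcf_product_carrier[of L f L]]
    by (intro that[of "mat L L (\<lambda>(i, j). b i j)" "mat L L (\<lambda>(i, j). a i j)"])
       (auto simp: vcf_multiplier_def lower_triangular_def upper_triangular_def a b)
qed

text \<open>Links the formal algorithm with the functions that the matrices act on. Convergence of
  the series is carried through the same induction, since otherwise \<open>eval_fps\<close> would
  say nothing about the functions. The identity lives on a punctured neighbourhood because
  \<open>T[k]\<close> has a pole at \<open>w = 0\<close>.\<close>

lemma vcf_product_apply:
  fixes F :: "nat \<Rightarrow> complex \<Rightarrow> complex"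
  assumes F: "\<And>i. i < L \<Longrightarrow> F i has_fps_expansion f i"
    and nz: "\<And>k i. k < n \<Longrightarrow> i < L \<Longrightarrow> fps_nth (vcf L f k i) 0 \<noteq> 0"
    and "i < L"
  shows "eval_fps (vcf L f n i) has_fps_expansion vcf L f n i \<and>
    eventually (\<lambda>w. (\<Sum>k<L. vcf_product L f n w $$ (i, k) * F k w) = eval_fps (vcf L f n i) w) (at 0)"
  using nz \<open>i < L\<close>
proof (induction n arbitrary: i)
  case 0
  have "(\<Sum>k<L. vcf_product L f 0 w $$ (i, k) * F k w) = F i w" for w
  proof -
    have "(\<Sum>k<L. vcf_product L f 0 w $$ (i, k) * F k w) = (\<Sum>k<L. if k = i then F k w else 0)"
      using "0.prems" by (intro sum.cong) auto
    thus ?thesis using "0.prems" by simp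
  qed
  moreover have "eventually (\<lambda>w. F i w = eval_fps (f i) w) (at 0)"
    using F[OF "0.prems"(2)] by (auto simp: has_fps_expansion_def eventually_at_filter elim: eventually_mono)
  moreover have "eval_fps (f i) has_fps_expansion f i"
    using F[OF "0.prems"(2)] by (intro eval_fps_has_fps_expansion) (simp add: has_fps_expansion_def)
  ultimately show ?case by (simp add: vcf_def)
next
  case (Suc n)
  define h where "h = vcf L f n"
  define c where "c = fps_nth (h (i - 1)) 0 / fps_nth (h i) 0"
  define S where "S w m = (\<Sum>k<L. vcf_product L f n w $$ (m, k) * F k w)" for w m
  have exp: "eval_fps (h m) has_fps_expansion h m"
    and ev: "eventually (\<lambda>w. S w m = eval_fps (h m) w) (at 0)" if "m < L" for m
    using Suc that by (auto simp: h_def S_def)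
  have step: "(\<Sum>k<L. vcf_product L f (Suc n) w $$ (i, k) * F k w) =
      (if i = 0 then S w (L - 1) else (S w (i - 1) - c * S w i) / w)" for w
  proof -
    have "(\<Sum>k<L. vcf_product L f (Suc n) w $$ (i, k) * F k w) =
      (\<Sum>k<L. (\<Sum>m<L. vcf_matrix L f n w $$ (i, m) * vcf_product L f n w $$ (m, k)) * F k w)"
      using Suc.prems(2) by (simp add: index_mult_mat_sum[where n = L] del: index_mult_mat)
    also have "\<dots> = (\<Sum>m<L. vcf_matrix L f n w $$ (i, m) * S w m)"
      unfolding S_def sum_distrib_left sum_distrib_right
      by (subst sum.swap) (simp add: mult.assoc)
    finally show ?thesis
      using Suc.prems(2) by (simp only: vcf_matrix_apply c_def h_def)
  qed
  have vcf_Suc: "vcf L f (Suc n) = vcf_step L h"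
    by (simp add: vcf_def h_def)
  show ?case
  proof (cases "i = 0")
    case True
    thus ?thesis
      using exp[of "L - 1"] ev[of "L - 1"] Suc.prems(2) step by (simp add: vcf_Suc vcf_step_def)
  next
    case False
    define D where "D = h (i - 1) - fps_const c * h i"
    \<comment> \<open>The genericity condition at step \<open>n\<close>: without a zero denominator,
      \<open>c\<close> cancels the constant terms, and the division by \<open>w\<close> is
      exact.\<close>
    have "fps_nth (h i) 0 \<noteq> 0" using Suc.prems by (simp add: h_def)
    hence "fps_nth D 0 = 0" by (simp add: D_def c_def)
    hence shift: "fps_X * fps_shift 1 D = D"
      by (intro fps_ext) (auto simp: fps_X_mult_nth)
    have new: "vcf L f (Suc n) i = fps_shift 1 D"
      using False by (simp add: vcf_Suc vcf_step_def D_def c_def)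
    have D: "(\<lambda>w. eval_fps (h (i - 1)) w - c * eval_fps (h i) w) has_fps_expansion D"
      unfolding D_def using Suc.prems(2)
      by (intro has_fps_expansion_diff has_fps_expansion_cmult_left exp) auto
    hence exp': "eval_fps (fps_shift 1 D) has_fps_expansion fps_shift 1 D"
      by (intro eval_fps_has_fps_expansion) (simp add: has_fps_expansion_def)
    from has_fps_expansion_mult[OF has_fps_expansion_fps_X this]
    have D': "(\<lambda>w. w * eval_fps (fps_shift 1 D) w) has_fps_expansion D"
      by (simp only: shift)
    \<comment> \<open>Two functions with the same expansion \<open>D\<close> agree near
      \<open>0\<close>; dividing by \<open>w\<close> then costs the point \<open>0\<close>
      itself.\<close>
    have "eventually (\<lambda>w. w * eval_fps (fps_shift 1 D) w =
        eval_fps (h (i - 1)) w - c * eval_fps (h i) w) (nhds 0)"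
      using conjunct2[OF D[unfolded has_fps_expansion_def]] conjunct2[OF D'[unfolded has_fps_expansion_def]]
      by eventually_elim simp
    hence "eventually (\<lambda>w. w \<noteq> 0 \<longrightarrow> w * eval_fps (fps_shift 1 D) w =
        eval_fps (h (i - 1)) w - c * eval_fps (h i) w) (at 0)"
      by (auto simp: eventually_at_filter elim: eventually_mono)
    moreover have "eventually (\<lambda>w::complex. w \<noteq> 0) (at 0)"
      by (simp add: eventually_at_filter)
    moreover have "i - 1 < L" using Suc.prems(2) by simp
    note ev[OF this] ev[OF Suc.prems(2)]
    ultimately have "eventually (\<lambda>w. (\<Sum>k<L. vcf_product L f (Suc n) w $$ (i, k) * F k w) =
        eval_fps (fps_shift 1 D) w) (at 0)"
      unfolding step
      by eventually_elim (use False in \<open>auto simp: field_simps\<close>)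
    thus ?thesis using exp' by (simp only: new)
  qed
qed

subsection \<open>Local expansions at infinity\<close>

text \<open>Liouville's theorem for entire functions with a limit at infinity. It serves twice: to
  make \<open>det R\<close> constant and to remove the polynomial part of the new coefficient
  matrix.\<close>

lemma poly_tendsto_at_infinity:
  fixes p :: "complex poly"
  assumes "(poly p \<longlongrightarrow> l) at_infinity"
  shows "p = [:l:]"
proof -
  have "poly p z = l" for z
    by (rule Liouville_weak[OF _ assms]) (intro holomorphic_intros)
  hence "poly p = poly [:l:]" by auto
  thus ?thesis by (simp only: poly_eq_poly_eq_iff)
qed

section \<open>Differentiation on the covering\<close>

lemma cov_proj_deriv_nonzero:
  assumes "fuchsian_covering N u X" "\<tau> \<in> cov_dom X"
  shows "deriv (cov_proj X) \<tau> \<noteq> 0"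
proof -
  have cov: "covering_space (cov_dom X) (cov_proj X) (- (u ` {..N+1}))"
    and hol: "cov_proj X holomorphic_on cov_dom X" and op: "open (cov_dom X)"
    using assms(1) by (auto simp: fuchsian_covering_def)
  obtain T U q where
    T: "\<tau> \<in> T" "openin (top_of_set (cov_dom X)) T" "homeomorphism T U (cov_proj X) q"
    by (rule covering_space_local_homeomorphism[OF cov assms(2)])
  \<comment> \<open>A covering map is locally injective, and an injective holomorphic map has no
    critical points. The chain rule factor can therefore be cancelled later.\<close>
  have "inj_on (cov_proj X) T"
    by (rule inj_on_inverseI[where g = q]) (rule homeomorphism_apply1[OF T(3)])
  moreover have "open T" "T \<subseteq> cov_dom X"
    using T(2) op openin_open_trans openin_imp_subset by blast+
  ultimately show ?thesis
    using T(1) hol holomorphic_injective_imp_regular holomorphic_on_subset by blast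
qed

lemma cov_proj_has_derivative:
  assumes "fuchsian_covering N u X" "\<tau> \<in> cov_dom X"
  shows "(cov_proj X has_field_derivative deriv (cov_proj X) \<tau>) (at \<tau>)"
  using assms by (auto simp: fuchsian_covering_def intro: holomorphic_derivI)

lemma cov_proj_nonzero:
  assumes "fuchsian_covering N u X" "\<tau> \<in> cov_dom X"
  shows "cov_proj X \<tau> \<noteq> 0"
  using assms by (metis exp_not_eq_zero fuchsian_covering_def)

lemma cov_log_has_derivative:
  assumes X: "fuchsian_covering N u X" and \<tau>: "\<tau> \<in> cov_dom X"
  shows "(cov_log X has_field_derivative deriv (cov_proj X) \<tau> / cov_proj X \<tau>) (at \<tau>)"
proof -
  have hol: "cov_log X holomorphic_on cov_dom X" and op: "open (cov_dom X)"
    and exp: "\<And>t. t \<in> cov_dom X \<Longrightarrow> exp (cov_log X t) = cov_proj X t"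
    using X by (auto simp: fuchsian_covering_def)
  have log: "(cov_log X has_field_derivative deriv (cov_log X) \<tau>) (at \<tau>)"
    using hol op \<tau> by (rule holomorphic_derivI)
  have "((\<lambda>t. exp (cov_log X t)) has_field_derivative exp (cov_log X \<tau>) * deriv (cov_log X) \<tau>) (at \<tau>)"
    using log by (auto intro!: derivative_eq_intros)
  hence "(cov_proj X has_field_derivative exp (cov_log X \<tau>) * deriv (cov_log X) \<tau>) (at \<tau>)"
    by (rule has_field_derivative_transform_within_open[OF _ op \<tau>]) (simp add: exp)
  hence "deriv (cov_proj X) \<tau> = cov_proj X \<tau> * deriv (cov_log X) \<tau>"
    using exp[OF \<tau>] DERIV_imp_deriv by auto
  thus ?thesis using log cov_proj_nonzero[OF X \<tau>] by simp
qed

text \<open>Lifting paths in the connected exterior of a disc, a single sheet already covers all of it.\<close>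

lemma cov_inf_surjective:
  assumes X: "fuchsian_covering N u X" and u: "u (N + 1) = 0"
  obtains r where "open (cov_inf X)" "cov_inf X \<subseteq> cov_dom X"
    "\<forall>z. r < norm z \<longrightarrow> (\<exists>\<tau>\<in>cov_inf X. cov_proj X \<tau> = z)"
proof -
  have cov: "covering_space (cov_dom X) (cov_proj X) (- (u ` {..N+1}))"
    and hol: "cov_proj X holomorphic_on cov_dom X" and op: "open (cov_dom X)"
    using X by (auto simp: fuchsian_covering_def)
  from X obtain r where r: "r > 0" "\<And>i. i \<le> N \<Longrightarrow> norm (u i) \<le> r"
    and comp: "cov_inf X \<in> components {\<tau> \<in> cov_dom X. r < norm (cov_proj X \<tau>)}"
    by (auto simp: fuchsian_covering_def)
  define V where "V = {\<tau> \<in> cov_dom X. r < norm (cov_proj X \<tau>)}"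
  have sub: "cov_inf X \<subseteq> V"
    using comp in_components_subset unfolding V_def by blast
  have "V = cov_dom X \<inter> cov_proj X -` (- cball 0 r)"
    by (auto simp: V_def)
  hence "open V"
    using continuous_open_preimage[OF holomorphic_on_imp_continuous_on[OF hol] op]
    by (simp add: open_Compl)
  hence open_inf: "open (cov_inf X)"
    using comp open_components unfolding V_def by blast
  have surj: "\<exists>\<tau>\<in>cov_inf X. cov_proj X \<tau> = z" if z: "r < norm z" for z
  proof -
    obtain \<tau>0 where \<tau>0: "\<tau>0 \<in> cov_inf X"
      using in_components_nonempty[OF comp] by blast
    hence \<tau>0V: "\<tau>0 \<in> V" using sub by blast
    have "path_connected (- cball (0::complex) r)"
      by (intro path_connected_complement_bounded_convex) auto
    moreover have "cov_proj X \<tau>0 \<in> - cball 0 r" "z \<in> - cball 0 r"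
      using z \<tau>0V by (auto simp: V_def)
    ultimately obtain g where g: "path g" "path_image g \<subseteq> - cball 0 r"
      "pathstart g = cov_proj X \<tau>0" "pathfinish g = z"
      unfolding path_connected_def by blast
    \<comment> \<open>The choice of \<open>r\<close> bounds only the \<open>u i\<close> with
      \<open>i \<le> N\<close>; the remaining singularity \<open>u (N + 1) = 0\<close> lies in the
      disc as its centre. The path thus avoids every singular point and can be lifted.\<close>
    have "norm (u i) \<le> r" if "i \<le> N + 1" for i
      using that r u by (cases "i \<le> N") (auto simp: le_Suc_eq)
    hence "- cball 0 r \<subseteq> - (u ` {..N+1})" by auto
    with g have "path_image g \<subseteq> - (u ` {..N+1})" by blast
    moreover have "\<tau>0 \<in> cov_dom X" using \<tau>0V by (simp add: V_def)
    ultimately obtain h where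
      h: "path h" "path_image h \<subseteq> cov_dom X" "pathstart h = \<tau>0"
         "\<And>t. t \<in> {0..1} \<Longrightarrow> cov_proj X (h t) = g t"
      using covering_space_lift_path_strong[OF cov _ g(1) _ g(3)] by metis
    have "path_image h \<subseteq> V"
    proof
      fix x assume x: "x \<in> path_image h"
      then obtain t where t: "t \<in> {0..1}" "x = h t" by (auto simp: path_image_def)
      hence "cov_proj X x \<in> path_image g" using h(4) by (auto simp: path_image_def)
      thus "x \<in> V" using x h(2) g(2) by (auto simp: V_def)
    qed
    \<comment> \<open>The lift is connected and starts in the component \<open>cov_inf X\<close>, so
      it stays there.\<close>
    hence "path_image h \<subseteq> cov_inf X"
      using components_maximal[OF comp, of "path_image h"] h(1,3) \<tau>0 connected_path_image
        pathstart_in_path_image by (auto simp: V_def)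
    moreover have "cov_proj X (pathfinish h) = z"
      using h(4)[of 1] g(4) by (simp add: pathfinish_def)
    ultimately show ?thesis using pathfinish_in_path_image by blast
  qed
  show ?thesis
    using sub surj by (intro that[of r] open_inf) (auto simp: V_def)
qed

lemma filterlim_one_over_at_infinity:
  "filterlim (\<lambda>z::complex. 1 / z) (at 0) at_infinity"
  using filterlim_inverse_at_iff[of "\<lambda>z::complex. z" at_infinity] filterlim_ident
  by (simp add: inverse_eq_divide)

text \<open>Column \<open>j\<close> of \<open>Y C^-1\<close> is column \<open>j\<close> of
  \<open>\<Phi>\<close> times \<open>w\<close> to the power \<open>\<epsilon> j\<close>.
  Differentiating it, with \<open>d/dz = - w^2 d/dw\<close>, and comparing with the equation lets
  the exponential and the chain rule factor cancel, so that a relation in \<open>z\<close> alone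
  remains. \<open>B\<close> is arbitrary because the relation is applied to a coefficient matrix
  whose polynomial part is not yet known to vanish.\<close>

lemma expansion_at_infinity_relation:
  assumes X: "fuchsian_covering N u X" and u: "u (N + 1) = 0"
    and B: "\<And>z. B z \<in> carrier_mat L L"
    and Y: "\<And>\<tau>. \<tau> \<in> cov_dom X \<Longrightarrow> Y \<tau> \<in> carrier_mat L L"
    and ode: "\<And>\<tau> i j. \<tau> \<in> cov_dom X \<Longrightarrow> i < L \<Longrightarrow> j < L \<Longrightarrow>
      ((\<lambda>t. Y t $$ (i, j)) has_field_derivative
         deriv (cov_proj X) \<tau> * (B (cov_proj X \<tau>) * Y \<tau>) $$ (i, j)) (at \<tau>)"
    and exp: "expansion_at_infinity L X \<epsilon> Y \<Phi> C"
    and ij: "i < L" "j < L"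
  shows "eventually (\<lambda>z. z * (B z * \<Phi> (1 / z)) $$ (i, j) =
     - (1 / z) * deriv (\<lambda>w. \<Phi> w $$ (i, j)) (1 / z) - \<epsilon> j * \<Phi> (1 / z) $$ (i, j)) at_infinity"
proof -
  let ?p = "cov_proj X" and ?\<phi> = "\<lambda>w. \<Phi> w $$ (i, j)"
  let ?e = "\<lambda>j \<tau>. exp (\<epsilon> j * (- cov_log X \<tau>))"
  have \<Phi>: "\<And>w. \<Phi> w \<in> carrier_mat L L" "?\<phi> analytic_on {0}"
    and C: "C \<in> carrier_mat L L" "invertible_mat C"
    using exp ij by (auto simp: expansion_at_infinity_def analytic_mat_at_0_def)
  from exp obtain s where s: "s > 0" "\<And>\<tau>. \<tau> \<in> cov_inf X \<Longrightarrow> norm (1 / ?p \<tau>) < s \<Longrightarrow>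
      Y \<tau> = \<Phi> (1 / ?p \<tau>) * mat_diag L (\<lambda>j. ?e j \<tau>) * C"
    by (auto simp: expansion_at_infinity_def)
  obtain r where r: "open (cov_inf X)" "cov_inf X \<subseteq> cov_dom X"
    "\<forall>z. r < norm z \<longrightarrow> (\<exists>\<tau>\<in>cov_inf X. ?p \<tau> = z)"
    by (rule cov_inf_surjective[OF X u])
  \<comment> \<open>Removing \<open>C\<close> on the right separates the exponents: each column of
    \<open>Y \<tau> * D\<close> involves only one of them.\<close>
  obtain D where D: "D \<in> carrier_mat L L" "C * D = 1\<^sub>m L"
    by (rule invertible_mat_right_inverse[OF C])
  have YD: "Y \<tau> * D = mat L L (\<lambda>(i, j). \<Phi> (1 / ?p \<tau>) $$ (i, j) * ?e j \<tau>)"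
    if "\<tau> \<in> cov_inf X" "norm (1 / ?p \<tau>) < s" for \<tau>
  proof -
    let ?M = "\<Phi> (1 / ?p \<tau>) * mat_diag L (\<lambda>j. ?e j \<tau>)"
    have "?M \<in> carrier_mat L L" by (rule mult_carrier_mat[OF \<Phi>(1) mat_diag_dim])
    hence "Y \<tau> * D = ?M"
      unfolding s(2)[OF that] using assoc_mult_mat[OF _ C(1) D(1)] D(2) right_mult_one_mat by metis
    thus ?thesis using mat_diag_mult_right[OF \<Phi>(1)] by simp
  qed
  have "eventually (\<lambda>z. ?\<phi> analytic_on {1 / z} \<and> norm (1 / z) < s) at_infinity"
  proof (rule eventually_compose_filterlim[OF _ filterlim_one_over_at_infinity])
    obtain A where A: "open A" "0 \<in> A" "?\<phi> analytic_on A"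
      using \<Phi>(2) analytic_on_open[of _ ?\<phi>] by (auto simp: analytic_at)
    have "eventually (\<lambda>w. w \<in> A \<and> w \<in> ball 0 s) (nhds 0)"
      using A s(1) by (intro eventually_conj eventually_nhds_in_open) auto
    thus "eventually (\<lambda>w. ?\<phi> analytic_on {w} \<and> norm w < s) (at 0)"
      unfolding eventually_at_filter
      by eventually_elim (use A(3) analytic_on_subset in auto)
  qed
  moreover have "eventually (\<lambda>z::complex. r < norm z) at_infinity"
    unfolding eventually_at_infinity by (intro exI[of _ "r + 1"]) auto
  ultimately show ?thesis
  proof eventually_elim
    case (elim z)
    \<comment> \<open>One preimage is enough, since both sides of the relation depend on
      \<open>z\<close> only.\<close>
    from r(3) elim obtain \<tau> where \<tau>: "\<tau> \<in> cov_inf X" "?p \<tau> = z" by blast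
    hence \<tau>': "\<tau> \<in> cov_dom X" using r(2) by blast
    have z: "z \<noteq> 0" using cov_proj_nonzero[OF X \<tau>'] \<tau>(2) by simp
    define W where "W = {t \<in> cov_inf X. norm (1 / ?p t) < s}"
    have "continuous_on (cov_inf X) (\<lambda>t. norm (1 / ?p t))"
    proof (intro continuous_intros)
      have "?p holomorphic_on cov_dom X" using X by (simp add: fuchsian_covering_def)
      thus "continuous_on (cov_inf X) ?p"
        using r(2) holomorphic_on_imp_continuous_on continuous_on_subset by blast
    qed (use r(2) cov_proj_nonzero[OF X] in blast)
    hence "open W"
      using continuous_open_preimage[OF _ r(1), of _ "{..<s}"] by (simp add: W_def vimage_def Int_def)
    have "\<tau> \<in> W" using \<tau> elim by (simp add: W_def)
    have d1: "((\<lambda>t. (Y t * D) $$ (i, j)) has_field_derivative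
        deriv ?p \<tau> * (B z * (Y \<tau> * D)) $$ (i, j)) (at \<tau>)"
    proof -
      have "((\<lambda>t. \<Sum>k<L. Y t $$ (i, k) * D $$ (k, j)) has_field_derivative
          (\<Sum>k<L. deriv ?p \<tau> * (B z * Y \<tau>) $$ (i, k) * D $$ (k, j))) (at \<tau>)"
        using ode[OF \<tau>' ij(1)] \<tau>(2) by (intro DERIV_sum DERIV_cmult_right) auto
      moreover have "(\<Sum>k<L. deriv ?p \<tau> * (B z * Y \<tau>) $$ (i, k) * D $$ (k, j)) =
          deriv ?p \<tau> * (B z * (Y \<tau> * D)) $$ (i, j)"
      proof -
        have BY: "B z * Y \<tau> \<in> carrier_mat L L" using B Y[OF \<tau>'] by (rule mult_carrier_mat)
        have "(B z * (Y \<tau> * D)) $$ (i, j) = ((B z * Y \<tau>) * D) $$ (i, j)"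
          using assoc_mult_mat[OF B Y[OF \<tau>'] D(1)] by simp
        also have "\<dots> = (\<Sum>k<L. (B z * Y \<tau>) $$ (i, k) * D $$ (k, j))"
          by (rule index_mult_mat_sum[OF BY D(1) ij])
        finally show ?thesis by (simp only: sum_distrib_left mult.assoc)
      qed
      ultimately have "((\<lambda>t. \<Sum>k<L. Y t $$ (i, k) * D $$ (k, j)) has_field_derivative
          deriv ?p \<tau> * (B z * (Y \<tau> * D)) $$ (i, j)) (at \<tau>)" by simp
      thus ?thesis
      proof (rule has_field_derivative_transform_within_open)
        show "open (cov_dom X)" using X by (simp add: fuchsian_covering_def)
      qed (use \<tau>' index_mult_mat_sum[OF Y D(1) ij] in auto)
    qed
    have "((\<lambda>t. ?\<phi> (1 / ?p t) * ?e j t) has_field_derivative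
        deriv ?p \<tau> * (- (1 / z\<^sup>2) * deriv ?\<phi> (1 / z) - (\<epsilon> j / z) * ?\<phi> (1 / z)) * ?e j \<tau>) (at \<tau>)"
    proof -
      have p: "(?p has_field_derivative deriv ?p \<tau>) (at \<tau>)"
        by (rule cov_proj_has_derivative[OF X \<tau>'])
      have l: "(cov_log X has_field_derivative deriv ?p \<tau> / z) (at \<tau>)"
        using cov_log_has_derivative[OF X \<tau>'] \<tau>(2) by simp
      have "(?\<phi> has_field_derivative deriv ?\<phi> (1 / z)) (at (1 / ?p \<tau>))"
        using elim \<tau>(2) analytic_derivI by blast
      moreover have "((\<lambda>t. 1 / ?p t) has_field_derivative - deriv ?p \<tau> / z\<^sup>2) (at \<tau>)"
        using p z \<tau>(2) by (auto intro!: derivative_eq_intros simp: power2_eq_square)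
      ultimately have "((\<lambda>t. ?\<phi> (1 / ?p t)) has_field_derivative
          deriv ?\<phi> (1 / z) * (- deriv ?p \<tau> / z\<^sup>2)) (at \<tau>)"
        by (rule DERIV_chain2)
      moreover have "(?e j has_field_derivative ?e j \<tau> * (\<epsilon> j * (- (deriv ?p \<tau> / z)))) (at \<tau>)"
        using l by (auto intro!: derivative_eq_intros)
      ultimately have "((\<lambda>t. ?\<phi> (1 / ?p t) * ?e j t) has_field_derivative
          deriv ?\<phi> (1 / z) * (- deriv ?p \<tau> / z\<^sup>2) * ?e j \<tau> +
          ?e j \<tau> * (\<epsilon> j * (- (deriv ?p \<tau> / z))) * ?\<phi> (1 / ?p \<tau>)) (at \<tau>)"
        by (rule DERIV_mult)
      thus ?thesis by (rule DERIV_cong) (use \<tau>(2) in \<open>simp add: algebra_simps\<close>)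
    qed
    hence "((\<lambda>t. (Y t * D) $$ (i, j)) has_field_derivative
        deriv ?p \<tau> * (- (1 / z\<^sup>2) * deriv ?\<phi> (1 / z) - (\<epsilon> j / z) * ?\<phi> (1 / z)) * ?e j \<tau>) (at \<tau>)"
      by (rule has_field_derivative_transform_within_open[OF _ \<open>open W\<close> \<open>\<tau> \<in> W\<close>])
         (use ij YD in \<open>auto simp: W_def\<close>)
    hence "deriv ?p \<tau> * (B z * (Y \<tau> * D)) $$ (i, j) =
        deriv ?p \<tau> * (- (1 / z\<^sup>2) * deriv ?\<phi> (1 / z) - (\<epsilon> j / z) * ?\<phi> (1 / z)) * ?e j \<tau>"
      using d1 DERIV_unique by blast
    moreover have "(B z * (Y \<tau> * D)) $$ (i, j) = (B z * \<Phi> (1 / z)) $$ (i, j) * ?e j \<tau>"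
    proof -
      have "(B z * (Y \<tau> * D)) $$ (i, j) =
          (\<Sum>k<L. B z $$ (i, k) * (\<Phi> (1 / z) $$ (k, j) * ?e j \<tau>))"
        using YD[OF \<tau>(1)] elim \<tau>(2) ij B
        by (subst index_mult_mat_sum[where n = L]) auto
      also have "\<dots> = (B z * \<Phi> (1 / z)) $$ (i, j) * ?e j \<tau>"
        unfolding index_mult_mat_sum[OF B \<Phi>(1) ij] sum_distrib_right by (simp add: mult.assoc)
      finally show ?thesis .
    qed
    ultimately have "(B z * \<Phi> (1 / z)) $$ (i, j) =
        - (1 / z\<^sup>2) * deriv ?\<phi> (1 / z) - (\<epsilon> j / z) * ?\<phi> (1 / z)"
      using cov_proj_deriv_nonzero[OF X \<tau>'] by (simp only: mult.assoc mult_cancel_left) simp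
    thus ?case using z by (simp add: field_simps power2_eq_square)
  qed
qed

text \<open>In the preceding relation the derivative of \<open>\<Phi>\<close> carries a factor
  \<open>1 / z\<close> and disappears in the limit. The rest is multiplied by the inverse of
  \<open>\<Phi> (1 / z)\<close>, which converges since \<open>\<Phi> 0\<close> is invertible.
  \<open>G\<close> is a two-sided inverse, so that the limit is visibly minus a conjugate of the
  matrix of exponents.\<close>

lemma expansion_at_infinity_limit:
  assumes X: "fuchsian_covering N u X" and u: "u (N + 1) = 0"
    and B: "\<And>z. B z \<in> carrier_mat L L"
    and Y: "\<And>\<tau>. \<tau> \<in> cov_dom X \<Longrightarrow> Y \<tau> \<in> carrier_mat L L"
    and ode: "\<And>\<tau> i j. \<tau> \<in> cov_dom X \<Longrightarrow> i < L \<Longrightarrow> j < L \<Longrightarrow>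
      ((\<lambda>t. Y t $$ (i, j)) has_field_derivative
         deriv (cov_proj X) \<tau> * (B (cov_proj X \<tau>) * Y \<tau>) $$ (i, j)) (at \<tau>)"
    and exp: "expansion_at_infinity L X \<epsilon> Y \<Phi> C"
  obtains G where "G \<in> carrier_mat L L" "\<Phi> 0 * G = 1\<^sub>m L" "G * \<Phi> 0 = 1\<^sub>m L"
    "\<forall>i<L. \<forall>j<L.
      ((\<lambda>z. z * B z $$ (i, j)) \<longlongrightarrow> - (\<Phi> 0 * mat_diag L \<epsilon> * G) $$ (i, j)) at_infinity"
proof -
  have \<Phi>: "\<And>w. \<Phi> w \<in> carrier_mat L L"
    and an: "\<And>i j. i < L \<Longrightarrow> j < L \<Longrightarrow> (\<lambda>w. \<Phi> w $$ (i, j)) analytic_on {0}"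
    and "invertible_mat (\<Phi> 0)"
    using exp by (auto simp: expansion_at_infinity_def analytic_mat_at_0_def)
  have det: "Determinant.det (\<Phi> 0) \<noteq> 0"
    by (rule invertible_mat_det_nonzero[OF \<Phi> \<open>invertible_mat (\<Phi> 0)\<close>])
  have lim0: "filterlim (\<lambda>z::complex. 1 / z) (nhds 0) at_infinity"
    using filterlim_one_over_at_infinity by (simp add: filterlim_at)
  have lim\<Phi>: "((\<lambda>z. \<Phi> (1 / z) $$ (i, j)) \<longlongrightarrow> \<Phi> 0 $$ (i, j)) at_infinity" if "i < L" "j < L" for i j
    by (rule isCont_tendsto_compose[where g = "\<lambda>w. \<Phi> w $$ (i, j)", OF _ lim0])
       (rule analytic_at_imp_isCont[OF an[OF that]])
  define G where "G z = adj_inverse (\<Phi> (1 / z))" for z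
  define G0 where "G0 = adj_inverse (\<Phi> 0)"
  have G: "G z \<in> carrier_mat L L" for z
    unfolding G_def by (rule adj_inverse_carrier[OF \<Phi>])
  have G0: "G0 \<in> carrier_mat L L"
    unfolding G0_def by (rule adj_inverse_carrier[OF \<Phi>])
  have G_lim: "((\<lambda>z. G z $$ (i, j)) \<longlongrightarrow> G0 $$ (i, j)) at_infinity" if "i < L" "j < L" for i j
    unfolding G_def G0_def by (rule tendsto_adj_inverse[where A = "\<lambda>z. \<Phi> (1 / z)", OF \<Phi> \<Phi> lim\<Phi> det that])
  have "((\<lambda>z. Determinant.det (\<Phi> (1 / z))) \<longlongrightarrow> Determinant.det (\<Phi> 0)) at_infinity"
    by (rule tendsto_det[where A = "\<lambda>z. \<Phi> (1 / z)", OF \<Phi> \<Phi> lim\<Phi>])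
  hence "eventually (\<lambda>z. Determinant.det (\<Phi> (1 / z)) \<noteq> 0) at_infinity"
    using det by (rule tendsto_imp_eventually_ne)
  hence G_inv: "eventually (\<lambda>z. \<Phi> (1 / z) * G z = 1\<^sub>m L) at_infinity"
    unfolding G_def by eventually_elim (rule adj_inverse(1)[OF \<Phi>])
  define K where "K z = z \<cdot>\<^sub>m (B z * \<Phi> (1 / z))" for z
  have K: "K z \<in> carrier_mat L L" for z
    using mult_carrier_mat[OF B \<Phi>] by (simp add: K_def)
  define K0 where "K0 = \<Phi> 0 * mat_diag L (\<lambda>j. - \<epsilon> j)"
  have K0: "K0 \<in> carrier_mat L L"
    unfolding K0_def by (rule mult_carrier_mat[OF \<Phi> mat_diag_dim])
  have K_lim: "((\<lambda>z. K z $$ (i, j)) \<longlongrightarrow> K0 $$ (i, j)) at_infinity" if ij: "i < L" "j < L" for i j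
  proof -
    let ?d = "deriv (\<lambda>w. \<Phi> w $$ (i, j))"
    have "((\<lambda>z. ?d (1 / z)) \<longlongrightarrow> ?d 0) at_infinity"
      by (rule isCont_tendsto_compose[where g = ?d, OF _ lim0])
         (rule analytic_at_imp_isCont[OF analytic_deriv[OF an[OF ij]]])
    hence "((\<lambda>z. - (1 / z) * ?d (1 / z) - \<epsilon> j * \<Phi> (1 / z) $$ (i, j)) \<longlongrightarrow>
        - 0 * ?d 0 - \<epsilon> j * \<Phi> 0 $$ (i, j)) at_infinity"
      by (intro tendsto_intros lim0 lim\<Phi> ij)
    moreover have "eventually (\<lambda>z. z * (B z * \<Phi> (1 / z)) $$ (i, j) =
        - (1 / z) * ?d (1 / z) - \<epsilon> j * \<Phi> (1 / z) $$ (i, j)) at_infinity"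
      by (rule expansion_at_infinity_relation[OF X u B _ _ exp ij])
         (auto intro: Y ode simp del: index_mult_mat)
    hence "eventually (\<lambda>z. - (1 / z) * ?d (1 / z) - \<epsilon> j * \<Phi> (1 / z) $$ (i, j) =
        K z $$ (i, j)) at_infinity"
    proof eventually_elim
      case (elim z)
      have "K z $$ (i, j) = z * (B z * \<Phi> (1 / z)) $$ (i, j)"
        using mult_carrier_mat[OF B[of z] \<Phi>[of "1/z"]] ij
        unfolding K_def by (intro index_smult_mat(1)) (auto simp del: index_mult_mat)
      thus ?case using elim by simp
    qed
    ultimately have "((\<lambda>z. K z $$ (i, j)) \<longlongrightarrow> - 0 * ?d 0 - \<epsilon> j * \<Phi> 0 $$ (i, j)) at_infinity"
      by (rule Lim_transform_eventually)
    moreover have "K0 $$ (i, j) = - \<epsilon> j * \<Phi> 0 $$ (i, j)"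
      using ij by (simp add: K0_def mat_diag_mult_right[OF \<Phi>])
    ultimately show ?thesis by simp
  qed
  show ?thesis
  proof (rule that[OF G0 adj_inverse[OF \<Phi> det, folded G0_def]], intro allI impI)
    fix i j assume ij: "i < L" "j < L"
    have "((\<lambda>z. (K z * G z) $$ (i, j)) \<longlongrightarrow> (K0 * G0) $$ (i, j)) at_infinity"
      by (rule tendsto_mult_mat[OF K G K0 G0 K_lim G_lim ij])
    moreover have "eventually (\<lambda>z. (K z * G z) $$ (i, j) = z * B z $$ (i, j)) at_infinity"
      using G_inv
    proof eventually_elim
      case (elim z)
      have "K z * G z = z \<cdot>\<^sub>m (B z * (\<Phi> (1 / z) * G z))"
        unfolding K_def mult_smult_assoc_mat[OF mult_carrier_mat[OF B \<Phi>] G]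
          assoc_mult_mat[OF B \<Phi> G] ..
      also have "\<dots> = z \<cdot>\<^sub>m B z" by (simp only: elim right_mult_one_mat[OF B])
      finally show ?case using B[of z] ij by auto
    qed
    ultimately have "((\<lambda>z. z * B z $$ (i, j)) \<longlongrightarrow> (K0 * G0) $$ (i, j)) at_infinity"
      by (rule Lim_transform_eventually)
    moreover have "K0 * G0 = - (\<Phi> 0 * mat_diag L \<epsilon> * G0)"
    proof -
      have "K0 = - (\<Phi> 0 * mat_diag L \<epsilon>)"
        unfolding K0_def mat_diag_mult_right[OF \<Phi>] by (auto intro!: eq_matI)
      thus ?thesis using G0 \<Phi>[of 0]
        carrier_matD[OF mat_diag_dim[of L \<epsilon>]]
        by (simp add: uminus_mult_left_mat)
    qed
    moreover have "\<Phi> 0 * mat_diag L \<epsilon> * G0 \<in> carrier_mat L L"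
      using \<Phi> G0 by (intro mult_carrier_mat) auto
    ultimately show "((\<lambda>z. z * B z $$ (i, j)) \<longlongrightarrow> - (\<Phi> 0 * mat_diag L \<epsilon> * G0) $$ (i, j)) at_infinity"
      using ij by (simp add: carrier_matD del: index_mult_mat)
  qed
qed

subsection \<open>Unimodular polynomial gauge transformations\<close>

text \<open>Matrices over the polynomial ring, rather than matrix-valued functions, make the
  adjugate of a matrix of determinant \<open>1\<close> a polynomial inverse. Identities proved there
  hold at every \<open>z\<close>, including the points \<open>u k\<close>.\<close>

abbreviation (input) eval_mat :: "'a::comm_semiring_0 poly mat \<Rightarrow> 'a \<Rightarrow> 'a mat" where
  "eval_mat P z \<equiv> map_mat (\<lambda>p. poly p z) P"

lemma eval_mat_mult:
  assumes "P \<in> carrier_mat n n" "Q \<in> carrier_mat n n"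
  shows "eval_mat (P * Q) z = eval_mat P z * eval_mat Q z"
proof (rule eq_matI)
  fix i j assume "i < dim_row (eval_mat P z * eval_mat Q z)" "j < dim_col (eval_mat P z * eval_mat Q z)"
  hence ij: "i < n" "j < n" using assms by auto
  have carr: "eval_mat P z \<in> carrier_mat n n" "eval_mat Q z \<in> carrier_mat n n"
    using assms by auto
  have "eval_mat (P * Q) z $$ (i, j) = poly ((P * Q) $$ (i, j)) z"
    using assms ij by (intro index_map_mat(1)) auto
  also have "\<dots> = (\<Sum>k<n. eval_mat P z $$ (i, k) * eval_mat Q z $$ (k, j))"
    unfolding index_mult_mat_sum[OF assms ij] poly_sum using assms ij by (intro sum.cong) auto
  finally show "eval_mat (P * Q) z $$ (i, j) = (eval_mat P z * eval_mat Q z) $$ (i, j)"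
    by (simp only: index_mult_mat_sum[OF carr ij])
qed (use assms in auto)

lemma eval_mat_one: "eval_mat (1\<^sub>m n :: 'a::comm_ring_1 poly mat) z = 1\<^sub>m n"
  by (rule eq_matI) auto

lemma det_eval_mat:
  fixes P :: "'a::comm_ring_1 poly mat"
  shows "Determinant.det (eval_mat P z) = poly (Determinant.det P) z"
  by (simp add: Determinant.det_def poly_sum poly_prod sign_def)

text \<open>By the factor theorem \<open>z - u k\<close> divides \<open>g k\<close> minus its value
  at \<open>u k\<close>; the quotients are collected in \<open>h\<close>. This identifies the
  residues of the conjugated coefficient matrix.\<close>

lemma partial_fractions_polynomial_numerators:
  fixes g :: "'b \<Rightarrow> complex poly"
  shows "\<exists>h. \<forall>z. (\<forall>k\<in>K. z \<noteq> u k) \<longrightarrow>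
    (\<Sum>k\<in>K. poly (g k) z / (z - u k)) = (\<Sum>k\<in>K. poly (g k) (u k) / (z - u k)) + poly h z"
proof -
  define q where "q k = (g k - [:poly (g k) (u k):]) div [:- u k, 1:]" for k
  have q: "poly (g k) z = poly (g k) (u k) + (z - u k) * poly (q k) z" for k z
  proof -
    have "[:- u k, 1:] dvd g k - [:poly (g k) (u k):]"
      by (simp flip: poly_eq_0_iff_dvd)
    hence "[:- u k, 1:] * q k = g k - [:poly (g k) (u k):]"
      unfolding q_def by (rule dvd_mult_div_cancel)
    from arg_cong[OF this, of "\<lambda>p. poly p z"] show ?thesis by (simp add: algebra_simps)
  qed
  have quot: "poly (g k) z / (z - u k) = poly (g k) (u k) / (z - u k) + poly (q k) z"
    if "z \<noteq> u k" for k z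
    using that by (subst q[of k z]) (simp add: add_divide_distrib)
  have "(\<Sum>k\<in>K. poly (g k) z / (z - u k)) =
      (\<Sum>k\<in>K. poly (g k) (u k) / (z - u k)) + poly (\<Sum>k\<in>K. q k) z"
    if "\<forall>k\<in>K. z \<noteq> u k" for z
    unfolding poly_sum sum.distrib[symmetric] using that by (intro sum.cong refl quot) auto
  thus ?thesis by blast
qed

text \<open>Each \<open>z / (z - u k)\<close> tends to \<open>1\<close>. The limit is the sum of the
  residues, that is, minus the entry of \<open>residue_at_infinity\<close>.\<close>

lemma tendsto_mult_sum_simple_poles:
  fixes a u :: "nat \<Rightarrow> complex"
  shows "((\<lambda>z. z * (\<Sum>k\<le>n. a k / (z - u k))) \<longlongrightarrow> (\<Sum>k\<le>n. a k)) at_infinity"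
proof -
  have lim0: "((\<lambda>z::complex. 1 / z) \<longlongrightarrow> 0) at_infinity"
    using filterlim_one_over_at_infinity by (simp add: filterlim_at)
  have "((\<lambda>z. a k * (z / (z - u k))) \<longlongrightarrow> a k) at_infinity" for k
  proof -
    have "((\<lambda>z. a k * (1 / (1 - u k * (1 / z)))) \<longlongrightarrow> a k * (1 / (1 - u k * 0))) at_infinity"
      by (intro tendsto_intros lim0) auto
    moreover have "eventually (\<lambda>z. a k * (1 / (1 - u k * (1 / z))) = a k * (z / (z - u k))) at_infinity"
      using eventually_not_equal_at_infinity[of 0] eventually_not_equal_at_infinity[of "u k"]
      by eventually_elim (simp add: field_simps)
    ultimately show ?thesis
      using Lim_transform_eventually by fastforce
  qed
  hence "((\<lambda>z. \<Sum>k\<le>n. a k * (z / (z - u k))) \<longlongrightarrow> (\<Sum>k\<le>n. a k)) at_infinity"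
    by (intro tendsto_sum)
  thus ?thesis by (simp add: sum_distrib_left algebra_simps)
qed

lemma system_matrix_carrier: "system_matrix L N u A z \<in> carrier_mat L L"
  by (simp add: system_matrix_def)

lemma system_matrix_conjugate:
  assumes A: "\<And>k. k \<le> N + 1 \<Longrightarrow> A k \<in> carrier_mat L L"
    and R: "R \<in> carrier_mat L L" and Q: "Q \<in> carrier_mat L L" and ij: "i < L" "j < L"
  shows "(R * system_matrix L N u A z * Q) $$ (i, j) =
    (\<Sum>k\<le>N+1. (R * A k * Q) $$ (i, j) / (z - u k))"
proof -
  have prod: "(R * M * Q) $$ (i, j) = (\<Sum>m<L. \<Sum>l<L. R $$ (i, l) * M $$ (l, m) * Q $$ (m, j))"
    if "M \<in> carrier_mat L L" for M
    unfolding index_mult_mat_sum[OF mult_carrier_mat[OF R that] Q ij]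
    using ij by (intro sum.cong refl) (simp add: index_mult_mat_sum[OF R that] sum_distrib_right del: index_mult_mat)
  have S: "system_matrix L N u A z $$ (l, m) = (\<Sum>k\<le>N+1. A k $$ (l, m) / (z - u k))"
    if "l < L" "m < L" for l m
    using that by (simp add: system_matrix_def)
  have "(R * system_matrix L N u A z * Q) $$ (i, j) =
      (\<Sum>m<L. \<Sum>l<L. \<Sum>k\<le>N+1. R $$ (i, l) * A k $$ (l, m) * Q $$ (m, j) / (z - u k))"
    unfolding prod[OF system_matrix_carrier]
    by (intro sum.cong refl) (simp only: S lessThan_iff sum_distrib_left sum_distrib_right
        times_divide_eq_right times_divide_eq_left)
  also have "\<dots> = (\<Sum>m<L. \<Sum>k\<le>N+1. \<Sum>l<L. R $$ (i, l) * A k $$ (l, m) * Q $$ (m, j) / (z - u k))"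
    by (intro sum.cong refl sum.swap)
  also have "\<dots> = (\<Sum>k\<le>N+1. \<Sum>m<L. \<Sum>l<L. R $$ (i, l) * A k $$ (l, m) * Q $$ (m, j) / (z - u k))"
    by (rule sum.swap)
  also have "\<dots> = (\<Sum>k\<le>N+1. (R * A k * Q) $$ (i, j) / (z - u k))"
    by (intro sum.cong refl) (simp add: prod[OF A] sum_divide_distrib del: index_mult_mat)
  finally show ?thesis .
qed

text \<open>The product rule gives \<open>R' Y + R S Y\<close> with \<open>S\<close> the coefficient
  matrix, and \<open>Y = Q Y'\<close> brings it into the form \<open>B Y'\<close>. \<open>Y'\<close>
  is tied to \<open>P\<close> only on the covering, because the multiplier of the algorithm agrees
  with a polynomial matrix only for \<open>z \<noteq> 0\<close>.\<close>

lemma gauge_transformed_solution: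
  assumes X: "fuchsian_covering N u X"
    and P: "P \<in> carrier_mat L L" and Q: "Q \<in> carrier_mat L L" and QP: "Q * P = 1\<^sub>m L"
    and Y: "solves_system L N u X A Y"
    and Y': "\<And>\<tau>. \<tau> \<in> cov_dom X \<Longrightarrow> Y' \<tau> = eval_mat P (cov_proj X \<tau>) * Y \<tau>"
    and \<tau>: "\<tau> \<in> cov_dom X" and ij: "i < L" "j < L"
  defines "B \<equiv> \<lambda>z. (eval_mat (map_mat pderiv P) z + eval_mat P z * system_matrix L N u A z) * eval_mat Q z"
  shows "((\<lambda>t. Y' t $$ (i, j)) has_field_derivative
     deriv (cov_proj X) \<tau> * (B (cov_proj X \<tau>) * Y' \<tau>) $$ (i, j)) (at \<tau>)"
proof -
  define z where "z = cov_proj X \<tau>"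
  define d where "d = deriv (cov_proj X) \<tau>"
  define R where "R = eval_mat P z"
  define R' where "R' = eval_mat (map_mat pderiv P) z"
  define S where "S = system_matrix L N u A z"
  have carr: "R \<in> carrier_mat L L" "R' \<in> carrier_mat L L" "S \<in> carrier_mat L L"
    using P by (auto simp: R_def R'_def S_def system_matrix_def)
  have Yc: "\<And>\<tau>. \<tau> \<in> cov_dom X \<Longrightarrow> Y \<tau> \<in> carrier_mat L L"
    using Y by (simp add: solves_system_def)
  have dp: "(cov_proj X has_field_derivative d) (at \<tau>)"
    unfolding d_def by (rule cov_proj_has_derivative[OF X \<tau>])
  have dY: "((\<lambda>t. Y t $$ (k, j)) has_field_derivative d * (S * Y \<tau>) $$ (k, j)) (at \<tau>)" if "k < L" for k
    using Y \<tau> ij that by (simp add: solves_system_def d_def S_def z_def del: index_mult_mat)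
  have "((\<lambda>t. \<Sum>k<L. poly (P $$ (i, k)) (cov_proj X t) * Y t $$ (k, j)) has_field_derivative
      (\<Sum>k<L. (poly (pderiv (P $$ (i, k))) z * d) * Y \<tau> $$ (k, j) +
         d * (S * Y \<tau>) $$ (k, j) * poly (P $$ (i, k)) z)) (at \<tau>)"
    unfolding z_def
    by (intro DERIV_sum DERIV_mult dY DERIV_chain2[OF poly_DERIV dp]) auto
  also have "(\<Sum>k<L. (poly (pderiv (P $$ (i, k))) z * d) * Y \<tau> $$ (k, j) +
         d * (S * Y \<tau>) $$ (k, j) * poly (P $$ (i, k)) z) =
      d * ((\<Sum>k<L. R' $$ (i, k) * Y \<tau> $$ (k, j)) + (\<Sum>k<L. R $$ (i, k) * (S * Y \<tau>) $$ (k, j)))"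
    using P ij by (simp add: R_def R'_def sum.distrib sum_distrib_left algebra_simps del: index_mult_mat)
  also have "\<dots> = d * (R' * Y \<tau> + R * (S * Y \<tau>)) $$ (i, j)"
    using ij carr Yc[OF \<tau>]
    by (simp add: index_mult_mat_sum[OF carr(2) Yc[OF \<tau>] ij]
          index_mult_mat_sum[OF carr(1) mult_carrier_mat[OF carr(3) Yc[OF \<tau>]] ij] carrier_matD
          del: index_mult_mat(1))
  also have "R' * Y \<tau> + R * (S * Y \<tau>) = B z * Y' \<tau>"
  proof -
    have Qc: "eval_mat Q z \<in> carrier_mat L L" using Q by simp
    have M: "R' + R * S \<in> carrier_mat L L"
      using carr by (intro add_carrier_mat mult_carrier_mat)
    have "eval_mat Q z * R = 1\<^sub>m L"
      unfolding R_def using eval_mat_mult[OF Q P] QP eval_mat_one by metis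
    hence "eval_mat Q z * Y' \<tau> = Y \<tau>"
      using assoc_mult_mat[OF Qc carr(1) Yc[OF \<tau>]] left_mult_one_mat[OF Yc[OF \<tau>]]
      by (simp add: Y'[OF \<tau>] R_def z_def)
    moreover have "Y' \<tau> \<in> carrier_mat L L"
      unfolding Y'[OF \<tau>] using P Yc[OF \<tau>] by (intro mult_carrier_mat) auto
    ultimately have "B z * Y' \<tau> = (R' + R * S) * Y \<tau>"
      unfolding B_def R_def[symmetric] R'_def[symmetric] S_def[symmetric]
      using assoc_mult_mat[OF M Qc] by simp
    also have "\<dots> = R' * Y \<tau> + R * (S * Y \<tau>)"
      using add_mult_distrib_mat[OF carr(2) mult_carrier_mat[OF carr(1,3)] Yc[OF \<tau>]]
        assoc_mult_mat[OF carr(1,3) Yc[OF \<tau>]] by simp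
    finally show ?thesis ..
  qed
  finally show ?thesis unfolding d_def z_def
  proof (rule has_field_derivative_transform_within_open)
    show "open (cov_dom X)" using X by (simp add: fuchsian_covering_def)
    fix t assume t: "t \<in> cov_dom X"
    show "(\<Sum>k<L. poly (P $$ (i, k)) (cov_proj X t) * Y t $$ (k, j)) = Y' t $$ (i, j)"
      unfolding Y'[OF t] using P ij Yc[OF t]
      by (subst index_mult_mat_sum[where n = L]) auto
  qed (rule \<tau>)
qed

text \<open>The transformed coefficient matrix has simple poles at the \<open>u k\<close> plus a polynomial part,
  which vanishes because the expansion at infinity makes the matrix \<open>O(1/z)\<close>.\<close>

lemma gauge_transformed_system:
  assumes X: "fuchsian_covering N u X" and u: "u (N + 1) = 0"
    and A: "\<And>k. k \<le> N + 1 \<Longrightarrow> A k \<in> carrier_mat L L"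
    and P: "P \<in> carrier_mat L L" and Q: "Q \<in> carrier_mat L L" and QP: "Q * P = 1\<^sub>m L"
    and Y: "solves_system L N u X A Y"
    and Y': "\<And>\<tau>. \<tau> \<in> cov_dom X \<Longrightarrow> Y' \<tau> = eval_mat P (cov_proj X \<tau>) * Y \<tau>"
    and exp: "expansion_at_infinity L X \<epsilon> Y' \<Phi> C"
  defines "A' \<equiv> \<lambda>k. eval_mat P (u k) * A k * eval_mat Q (u k)"
  obtains G where "solves_system L N u X A' Y'"
    "G \<in> carrier_mat L L" "\<Phi> 0 * G = 1\<^sub>m L" "G * \<Phi> 0 = 1\<^sub>m L"
    "residue_at_infinity L N A' = \<Phi> 0 * mat_diag L \<epsilon> * G"
proof -
  define B where "B z = (eval_mat (map_mat pderiv P) z + eval_mat P z * system_matrix L N u A z) * eval_mat Q z" for z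
  have carr: "eval_mat P z \<in> carrier_mat L L" "eval_mat Q z \<in> carrier_mat L L"
    "eval_mat (map_mat pderiv P) z \<in> carrier_mat L L" for z
    using P Q by auto
  have B: "B z \<in> carrier_mat L L" for z
    unfolding B_def
    by (rule mult_carrier_mat[OF add_carrier_mat[OF mult_carrier_mat[OF carr(1) system_matrix_carrier]] carr(2)])
  have Y'c: "Y' \<tau> \<in> carrier_mat L L" if "\<tau> \<in> cov_dom X" for \<tau>
    using Y that unfolding Y'[OF that] by (intro mult_carrier_mat[OF carr(1)]) (simp add: solves_system_def)
  have ode: "((\<lambda>t. Y' t $$ (i, j)) has_field_derivative
     deriv (cov_proj X) \<tau> * (B (cov_proj X \<tau>) * Y' \<tau>) $$ (i, j)) (at \<tau>)"
    if "\<tau> \<in> cov_dom X" "i < L" "j < L" for \<tau> i j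
    unfolding B_def by (rule gauge_transformed_solution[OF X P Q QP Y Y' that])
  obtain G where G: "G \<in> carrier_mat L L" "\<Phi> 0 * G = 1\<^sub>m L" "G * \<Phi> 0 = 1\<^sub>m L"
    and B_lim: "\<forall>i<L. \<forall>j<L.
      ((\<lambda>z. z * B z $$ (i, j)) \<longlongrightarrow> - (\<Phi> 0 * mat_diag L \<epsilon> * G) $$ (i, j)) at_infinity"
    by (rule expansion_at_infinity_limit[OF X u B Y'c ode exp])
  have main: "(\<forall>z. (\<forall>k\<le>N+1. z \<noteq> u k) \<longrightarrow> B z $$ (i, j) = system_matrix L N u A' z $$ (i, j)) \<and>
      residue_at_infinity L N A' $$ (i, j) = (\<Phi> 0 * mat_diag L \<epsilon> * G) $$ (i, j)"
    if ij: "i < L" "j < L" for i j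
  proof -
    \<comment> \<open>Lifting \<open>A k\<close> to constant polynomials makes the numerator over
      \<open>z - u k\<close> a polynomial, whose value at \<open>u k\<close> is the entry of
      \<open>A' k\<close>.\<close>
    define g where "g k = (P * map_mat (\<lambda>a. [:a:]) (A k) * Q) $$ (i, j)" for k
    have g: "poly (g k) z = (eval_mat P z * A k * eval_mat Q z) $$ (i, j)" if "k \<le> N + 1" for k z
    proof -
      have c: "map_mat (\<lambda>a. [:a:]) (A k) \<in> carrier_mat L L" using A[OF that] by simp
      have "eval_mat (map_mat (\<lambda>a. [:a:]) (A k)) z = A k" by (rule eq_matI) auto
      hence "eval_mat (P * map_mat (\<lambda>a. [:a:]) (A k) * Q) z = eval_mat P z * A k * eval_mat Q z"
        using eval_mat_mult[OF mult_carrier_mat[OF P c] Q] eval_mat_mult[OF P c] by simp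
      moreover have "eval_mat (P * map_mat (\<lambda>a. [:a:]) (A k) * Q) z $$ (i, j) = poly (g k) z"
        unfolding g_def using P Q ij by (intro index_map_mat(1)) auto
      ultimately show ?thesis by simp
    qed
    obtain h0 where h0: "\<And>z. (\<forall>k\<in>{..N+1}. z \<noteq> u k) \<Longrightarrow> (\<Sum>k\<le>N+1. poly (g k) z / (z - u k)) =
        (\<Sum>k\<le>N+1. poly (g k) (u k) / (z - u k)) + poly h0 z"
      using partial_fractions_polynomial_numerators[of "{..N+1}" u g] by blast
    define h where "h = h0 + (map_mat pderiv P * Q) $$ (i, j)"
    have S': "system_matrix L N u A' z $$ (i, j) = (\<Sum>k\<le>N+1. poly (g k) (u k) / (z - u k))" for z
      using ij g by (simp add: system_matrix_def A'_def del: index_mult_mat)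
    have B_eq: "B z $$ (i, j) = system_matrix L N u A' z $$ (i, j) + poly h z"
      if z: "\<forall>k\<le>N+1. z \<noteq> u k" for z
    proof -
      let ?R' = "eval_mat (map_mat pderiv P) z"
      have "B z = ?R' * eval_mat Q z + eval_mat P z * system_matrix L N u A z * eval_mat Q z"
        unfolding B_def
        by (rule add_mult_distrib_mat[OF carr(3) mult_carrier_mat[OF carr(1) system_matrix_carrier] carr(2)])
      hence "B z $$ (i, j) = (?R' * eval_mat Q z) $$ (i, j) +
          (eval_mat P z * system_matrix L N u A z * eval_mat Q z) $$ (i, j)"
        using ij carr by (simp del: index_mult_mat(1))
      also have "(?R' * eval_mat Q z) $$ (i, j) = poly ((map_mat pderiv P * Q) $$ (i, j)) z"
      proof -
        have "?R' * eval_mat Q z = eval_mat (map_mat pderiv P * Q) z"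
          using P Q by (intro eval_mat_mult[symmetric]) auto
        thus ?thesis using P Q ij by (simp del: index_mult_mat(1))
      qed
      also have "(eval_mat P z * system_matrix L N u A z * eval_mat Q z) $$ (i, j) =
          (\<Sum>k\<le>N+1. poly (g k) z / (z - u k))"
      proof -
        have "(eval_mat P z * system_matrix L N u A z * eval_mat Q z) $$ (i, j) =
            (\<Sum>k\<le>N+1. (eval_mat P z * A k * eval_mat Q z) $$ (i, j) / (z - u k))"
          by (rule system_matrix_conjugate[OF A carr(1,2) ij])
        also have "\<dots> = (\<Sum>k\<le>N+1. poly (g k) z / (z - u k))"
          by (intro sum.cong refl) (simp only: g atMost_iff)
        finally show ?thesis .
      qed
      also have "\<dots> = system_matrix L N u A' z $$ (i, j) + poly h0 z"
        unfolding S' using z by (intro h0) auto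
      finally show ?thesis by (simp add: h_def)
    qed
    have S'_lim: "((\<lambda>z. z * system_matrix L N u A' z $$ (i, j)) \<longlongrightarrow> (\<Sum>k\<le>N+1. poly (g k) (u k))) at_infinity"
      unfolding S' by (rule tendsto_mult_sum_simple_poles)
    have nonsing: "eventually (\<lambda>z. \<forall>k\<in>{..N+1}. z \<noteq> u k) at_infinity"
      by (intro eventually_ball_finite) (auto intro: eventually_not_equal_at_infinity)
    have lim0: "((\<lambda>z::complex. 1 / z) \<longlongrightarrow> 0) at_infinity"
      using filterlim_one_over_at_infinity by (simp add: filterlim_at)
    \<comment> \<open>Multiplied by \<open>z\<close>, both matrices converge: \<open>B\<close> by
      the expansion of \<open>Y'\<close>, the other as a sum of simple poles. Dividing their
      difference by \<open>z\<close> leaves \<open>h\<close>, which therefore tends to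
      \<open>0\<close>.\<close>
    have "((\<lambda>z. 1 / z * (z * B z $$ (i, j) - z * system_matrix L N u A' z $$ (i, j))) \<longlongrightarrow>
        0 * (- (\<Phi> 0 * mat_diag L \<epsilon> * G) $$ (i, j) - (\<Sum>k\<le>N+1. poly (g k) (u k)))) at_infinity"
      by (intro tendsto_mult tendsto_diff lim0 B_lim[rule_format] S'_lim ij)
    moreover have "eventually (\<lambda>z. 1 / z * (z * B z $$ (i, j) - z * system_matrix L N u A' z $$ (i, j)) =
        poly h z) at_infinity"
      using nonsing eventually_not_equal_at_infinity[of 0]
      by eventually_elim (simp add: B_eq field_simps)
    ultimately have "(poly h \<longlongrightarrow> 0) at_infinity"
      using Lim_transform_eventually by fastforce
    hence "h = 0" using poly_tendsto_at_infinity by fastforce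
    hence eq: "B z $$ (i, j) = system_matrix L N u A' z $$ (i, j)" if "\<forall>k\<le>N+1. z \<noteq> u k" for z
      using B_eq[OF that] by simp
    \<comment> \<open>Once \<open>h = 0\<close>, the same two limits coincide, and this determines
      the new residue at infinity.\<close>
    have "eventually (\<lambda>z. z * B z $$ (i, j) = z * system_matrix L N u A' z $$ (i, j)) at_infinity"
      using nonsing by eventually_elim (simp add: eq)
    hence "((\<lambda>z. z * system_matrix L N u A' z $$ (i, j)) \<longlongrightarrow>
        - (\<Phi> 0 * mat_diag L \<epsilon> * G) $$ (i, j)) at_infinity"
      using B_lim[rule_format, OF ij] Lim_transform_eventually by fast
    hence "(\<Sum>k\<le>N+1. poly (g k) (u k)) = - (\<Phi> 0 * mat_diag L \<epsilon> * G) $$ (i, j)"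
      using S'_lim tendsto_unique[OF trivial_limit_at_infinity] by blast
    moreover have "residue_at_infinity L N A' $$ (i, j) = - (\<Sum>k\<le>N+1. poly (g k) (u k))"
      using ij g by (simp add: residue_at_infinity_def A'_def del: index_mult_mat)
    ultimately show ?thesis using eq by simp
  qed
  have \<Phi>0: "\<Phi> 0 \<in> carrier_mat L L"
    using exp by (simp add: expansion_at_infinity_def analytic_mat_at_0_def)
  have "B (cov_proj X \<tau>) = system_matrix L N u A' (cov_proj X \<tau>)" if "\<tau> \<in> cov_dom X" for \<tau>
  proof -
    have "cov_proj X ` cov_dom X = - (u ` {..N+1})"
      using X by (auto simp: fuchsian_covering_def dest: covering_space_imp_surjective)
    hence "\<forall>k\<le>N+1. cov_proj X \<tau> \<noteq> u k" using that by auto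
    thus ?thesis using main B[of "cov_proj X \<tau>"] system_matrix_carrier[of L N u A' "cov_proj X \<tau>"]
      by (intro eq_matI) auto
  qed
  hence "solves_system L N u X A' Y'"
    using ode Y'c by (simp add: solves_system_def del: index_mult_mat)
  moreover have "residue_at_infinity L N A' = \<Phi> 0 * mat_diag L \<epsilon> * G"
  proof (rule eq_matI)
    fix i j assume "i < dim_row (\<Phi> 0 * mat_diag L \<epsilon> * G)" "j < dim_col (\<Phi> 0 * mat_diag L \<epsilon> * G)"
    hence "i < L" "j < L" using \<Phi>0 G(1) by auto
    thus "residue_at_infinity L N A' $$ (i, j) = (\<Phi> 0 * mat_diag L \<epsilon> * G) $$ (i, j)"
      using main by blast
  qed (use \<Phi>0 G(1) in \<open>auto simp: residue_at_infinity_def\<close>)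
  ultimately show ?thesis using that G by blast
qed

subsection \<open>The multiplier of the algorithm\<close>

lemma det_mat_diag: "Determinant.det (mat_diag n d) = (\<Prod>i<n. d i)"
proof -
  have "Determinant.det (mat_diag n d) = prod_list (diag_mat (mat_diag n d))"
    by (rule det_upper_triangular[OF _ mat_diag_dim]) (auto simp: mat_diag_def upper_triangular_def)
  thus ?thesis
    by (simp add: prod_list_diag_prod mat_diag_def lessThan_atLeast0)
qed

lemma det_unitriangular:
  assumes "A \<in> carrier_mat n n" "upper_triangular A" "\<And>i. i < n \<Longrightarrow> A $$ (i, i) = 1"
  shows "Determinant.det A = 1"
  using det_upper_triangular[OF assms(2,1)] assms(1,3) by (simp add: prod_list_diag_prod)

text \<open>\<open>\<Phi>'(w) = R(1/w) \<Phi>(w) diag(w\<^sup>1\<^sup>-\<^sup>L, w, \<dots>, w)\<close> is regular at \<open>0\<close>: its first column is \<open>f[L]\<close>,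
  and \<open>w R(1/w)\<close> is a polynomial.  As the diagonal factor has determinant \<open>1\<close>, the polynomial
  \<open>det R\<close> has a limit at infinity, so it is constant.\<close>

lemma vcf_multiplier_shifts_expansion:
  fixes \<epsilon> :: "nat \<Rightarrow> complex" and B0 B1 :: "complex mat"
  assumes X: "fuchsian_covering N u X" and u: "u (N + 1) = 0" and L: "L > 0"
    and exp: "expansion_at_infinity L X \<epsilon> Y \<Phi> C"
    and f: "\<And>i. i < L \<Longrightarrow> f i = fps_expansion (\<lambda>w. \<Phi> w $$ (i, 0)) 0"
    and nz: "\<And>k i. k < L \<Longrightarrow> i < L \<Longrightarrow> fps_nth (vcf L f k i) 0 \<noteq> 0"
    and B: "B0 \<in> carrier_mat L L" "B1 \<in> carrier_mat L L" "lower_triangular B1"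
    and det_B0: "Determinant.det B0 = 1"
    and R: "\<And>z. z \<noteq> 0 \<Longrightarrow> vcf_multiplier L f z = B0 + z \<cdot>\<^sub>m B1"
  defines "P \<equiv> mat L L (\<lambda>(i, j). [:B0 $$ (i, j), B1 $$ (i, j):])"
  shows "Determinant.det P = 1" (is ?det)
    and "\<exists>\<Phi>'. expansion_at_infinity L X (\<lambda>j. \<epsilon> j + of_int (if j = 0 then int L - 1 else - 1))
           (\<lambda>\<tau>. vcf_multiplier L f (cov_proj X \<tau>) * Y \<tau>) \<Phi>' C" (is ?exp)
proof -
  have \<Phi>: "\<And>w. \<Phi> w \<in> carrier_mat L L"
    and an: "\<And>i j. i < L \<Longrightarrow> j < L \<Longrightarrow> (\<lambda>w. \<Phi> w $$ (i, j)) analytic_on {0}"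
    and \<Phi>0: "lower_triangular (\<Phi> 0)" "invertible_mat (\<Phi> 0)"
    and C: "C \<in> carrier_mat L L" "invertible_mat C"
    using exp by (auto simp: expansion_at_infinity_def analytic_mat_at_0_def)
  define c where "c i = eval_fps (vcf L f L i)" for i
  have c: "c i has_fps_expansion vcf L f L i"
    "eventually (\<lambda>w. (\<Sum>k<L. vcf_product L f L w $$ (i, k) * \<Phi> w $$ (k, 0)) = c i w) (at 0)"
    if "i < L" for i
  proof -
    have "(\<lambda>w. \<Phi> w $$ (k, 0)) has_fps_expansion f k" if "k < L" for k
      using an[OF that L] f[OF that] analytic_at_imp_has_fps_expansion_0 by simp
    from vcf_product_apply[where F = "\<lambda>k w. \<Phi> w $$ (k, 0)" and n = L, OF this nz that]
    show "c i has_fps_expansion vcf L f L i"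
      "eventually (\<lambda>w. (\<Sum>k<L. vcf_product L f L w $$ (i, k) * \<Phi> w $$ (k, 0)) = c i w) (at 0)"
      by (auto simp: c_def)
  qed
  \<comment> \<open>The formulas are chosen to make sense at \<open>w = 0\<close>; the product with
    \<open>R(1/w)\<close> that they represent is available only for \<open>w \<noteq> 0\<close> and
    is recovered in \<open>key\<close>.\<close>
  define \<Phi>' where "\<Phi>' w = mat L L (\<lambda>(i, j). if j = 0 then c i w
      else \<Sum>k<L. (B1 $$ (i, k) + w * B0 $$ (i, k)) * \<Phi> w $$ (k, j))" for w
  have \<Phi>': "\<Phi>' w \<in> carrier_mat L L" for w
    by (simp add: \<Phi>'_def)
  have an': "(\<lambda>w. \<Phi>' w $$ (i, j)) analytic_on {0}" if "i < L" "j < L" for i j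
  proof (cases "j = 0")
    case True
    thus ?thesis using that has_fps_expansion_imp_analytic_0[OF c(1)] by (simp add: \<Phi>'_def)
  next
    case False
    have "(\<lambda>w. \<Sum>k<L. (B1 $$ (i, k) + w * B0 $$ (i, k)) * \<Phi> w $$ (k, j)) analytic_on {0}"
      using that by (intro analytic_intros an) auto
    thus ?thesis using that False by (simp add: \<Phi>'_def)
  qed
  \<comment> \<open>These are the powers of \<open>w\<close> opposite to the shifts of the
    exponents. Since the shifts add up to \<open>0\<close>, their product is
    \<open>1\<close>.\<close>
  define d where "d w j = (if j = 0 then w powi (1 - int L) else w)" for w :: complex and j :: nat
  have P: "P \<in> carrier_mat L L" by (simp add: P_def)
  have RP: "vcf_multiplier L f z = eval_mat P z" if "z \<noteq> 0" for z
    unfolding R[OF that] P_def using B by (intro eq_matI) auto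
  have key: "eventually (\<lambda>w. w \<noteq> 0 \<and> \<Phi>' w = eval_mat P (1 / w) * \<Phi> w * mat_diag L (d w)) (at 0)"
  proof -
    have "eventually (\<lambda>w. \<forall>i\<in>{..<L}.
        (\<Sum>k<L. vcf_product L f L w $$ (i, k) * \<Phi> w $$ (k, 0)) = c i w) (at 0)"
      by (intro eventually_ball_finite) (auto intro: c(2))
    moreover have "eventually (\<lambda>w::complex. w \<noteq> 0) (at 0)"
      by (simp add: eventually_at_filter)
    ultimately show ?thesis
    proof eventually_elim
      case (elim w)
      have RPc: "eval_mat P (1 / w) \<in> carrier_mat L L" using P by simp
      have "\<Phi>' w = eval_mat P (1 / w) * \<Phi> w * mat_diag L (d w)"
      proof (rule eq_matI)
        fix i j assume "i < dim_row (eval_mat P (1 / w) * \<Phi> w * mat_diag L (d w))"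
          "j < dim_col (eval_mat P (1 / w) * \<Phi> w * mat_diag L (d w))"
        hence ij: "i < L" "j < L" using P carrier_matD[OF mat_diag_dim[of L "d w"]] by auto
        have "(eval_mat P (1 / w) * \<Phi> w * mat_diag L (d w)) $$ (i, j) =
            (\<Sum>k<L. eval_mat P (1 / w) $$ (i, k) * \<Phi> w $$ (k, j)) * d w j"
          unfolding mat_diag_mult_right[OF mult_carrier_mat[OF RPc \<Phi>]]
          using ij by (simp add: index_mult_mat_sum[OF RPc \<Phi> ij] del: index_mult_mat(1))
        also have "\<dots> = \<Phi>' w $$ (i, j)"
        proof (cases "j = 0")
          case True
          have "eval_mat P (1 / w) $$ (i, k) = (1 / w) powi (1 - int L) * vcf_product L f L w $$ (i, k)"
            if "k < L" for k
            using ij that elim carrier_matD[OF vcf_product_carrier[of L f L w]]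
            by (simp add: RP[symmetric] vcf_multiplier_def)
          hence "(\<Sum>k<L. eval_mat P (1 / w) $$ (i, k) * \<Phi> w $$ (k, j)) =
              (1 / w) powi (1 - int L) * c i w"
            using True ij elim by (simp add: sum_distrib_left[symmetric] mult.assoc)
          \<comment> \<open>The prefactor \<open>z^(1-L)\<close> is \<open>w^(L-1)\<close>; the
            scaling of column \<open>0\<close> cancels it and leaves \<open>f[L]\<close>
            itself.\<close>
          moreover have "(1 / w) powi (1 - int L) * w powi (1 - int L) = 1"
            using elim by (simp flip: power_int_mult_distrib)
          ultimately show ?thesis
            using True ij by (simp add: \<Phi>'_def d_def mult_ac)
        next
          case False
          have "(\<Sum>k<L. eval_mat P (1 / w) $$ (i, k) * \<Phi> w $$ (k, j)) * w =
              (\<Sum>k<L. (B1 $$ (i, k) + w * B0 $$ (i, k)) * \<Phi> w $$ (k, j))"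
            unfolding sum_distrib_right
            using ij elim by (intro sum.cong refl) (simp add: P_def field_simps)
          thus ?thesis using False ij by (simp add: \<Phi>'_def d_def)
        qed
        finally show "\<Phi>' w $$ (i, j) = (eval_mat P (1 / w) * \<Phi> w * mat_diag L (d w)) $$ (i, j)" ..
      qed (use P carrier_matD[OF mat_diag_dim[of L "d w"]] in \<open>auto simp: \<Phi>'_def\<close>)
      thus ?case using elim by blast
    qed
  qed
  have det_d: "Determinant.det (mat_diag L (d w)) = 1" if "w \<noteq> 0" for w
  proof -
    obtain l where l: "L = Suc l" using L not0_implies_Suc by blast
    have "(\<Prod>j<L. d w j) = w powi (- int l) * w ^ l"
      unfolding l prod.lessThan_Suc_shift by (simp add: d_def l)
    also have "\<dots> = 1" using that by (simp add: power_int_minus)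
    finally show ?thesis by (simp add: det_mat_diag)
  qed
  have lim: "((\<lambda>w. M w $$ (i, j)) \<longlongrightarrow> M 0 $$ (i, j)) (at 0)"
    if "(\<lambda>w. M w $$ (i, j)) analytic_on {0}" for M :: "complex \<Rightarrow> complex mat" and i j
    using analytic_at_imp_isCont[OF that] by (simp add: isCont_def)
  have det\<Phi>0: "Determinant.det (\<Phi> 0) \<noteq> 0"
    by (rule invertible_mat_det_nonzero[OF \<Phi> \<Phi>0(2)])
  define l where "l = Determinant.det (\<Phi>' 0) / Determinant.det (\<Phi> 0)"
  have lim_det: "((\<lambda>w. Determinant.det (\<Phi> w)) \<longlongrightarrow> Determinant.det (\<Phi> 0)) (at 0)"
    by (rule tendsto_det[where A = \<Phi>, OF \<Phi> \<Phi> lim[OF an]])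
  have lim_det': "((\<lambda>w. Determinant.det (\<Phi>' w)) \<longlongrightarrow> Determinant.det (\<Phi>' 0)) (at 0)"
    by (rule tendsto_det[where A = \<Phi>', OF \<Phi>' \<Phi>' lim[OF an']])
  have "((\<lambda>w. Determinant.det (\<Phi>' w) / Determinant.det (\<Phi> w)) \<longlongrightarrow> l) (at 0)"
    unfolding l_def by (rule tendsto_divide[OF lim_det' lim_det det\<Phi>0])
  moreover have "eventually (\<lambda>w. Determinant.det (\<Phi>' w) / Determinant.det (\<Phi> w) =
      poly (Determinant.det P) (1 / w)) (at 0)"
    using key tendsto_imp_eventually_ne[OF lim_det det\<Phi>0]
  proof eventually_elim
    case (elim w)
    have RPc: "eval_mat P (1 / w) \<in> carrier_mat L L" using P by simp
    have "Determinant.det (\<Phi>' w) = poly (Determinant.det P) (1 / w) * Determinant.det (\<Phi> w)"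
      using elim det_mult[OF mult_carrier_mat[OF RPc \<Phi>] mat_diag_dim, of w "d w"] det_mult[OF RPc \<Phi>]
      by (simp add: det_eval_mat det_d)
    thus ?case using elim by simp
  qed
  ultimately have "((\<lambda>w. poly (Determinant.det P) (1 / w)) \<longlongrightarrow> l) (at 0)"
    by (rule Lim_transform_eventually)
  from filterlim_compose[OF this filterlim_one_over_at_infinity]
  have "(poly (Determinant.det P) \<longlongrightarrow> l) at_infinity"
    by simp
  hence det_P: "Determinant.det P = [:l:]"
    by (rule poly_tendsto_at_infinity)
  \<comment> \<open>The constant found at infinity is evaluated at the opposite point
    \<open>z = 0\<close>, where \<open>B0\<close> is known.\<close>
  have "eval_mat P 0 = B0"
    using B by (intro eq_matI) (auto simp: P_def)
  hence "l = 1"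
    using det_eval_mat[where P = P and z = 0] det_B0 det_P by simp
  thus ?det using det_P by (simp add: one_pCons)
  \<comment> \<open>The limit \<open>l\<close> is also the quotient of the two leading determinants,
    so \<open>l = 1\<close> makes the new leading coefficient invertible.\<close>
  have "Determinant.det (\<Phi>' 0) \<noteq> 0"
    using \<open>l = 1\<close> det\<Phi>0 by (auto simp: l_def)
  hence inv': "invertible_mat (\<Phi>' 0)"
    using adj_inverse[OF \<Phi>'[of 0]] \<Phi>'[of 0] adj_inverse_carrier[OF \<Phi>'[of 0]]
    by (auto simp: invertible_mat_def inverts_mat_def intro!: exI[of _ "adj_inverse (\<Phi>' 0)"])
  have low': "lower_triangular (\<Phi>' 0)"
  proof -
    \<comment> \<open>An entry above the diagonal never lies in column \<open>0\<close>, so the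
      second formula for \<open>\<Phi>'\<close> applies; at \<open>w = 0\<close> it reads
      \<open>B1 * \<Phi> 0\<close>.\<close>
    have "\<Phi>' 0 $$ (i, j) = 0" if ij: "i < j" "j < L" for i j
    proof -
      have "\<Phi>' 0 $$ (i, j) = (B1 * \<Phi> 0) $$ (i, j)"
        using ij index_mult_mat_sum[OF B(2) \<Phi>, of i j] by (simp add: \<Phi>'_def del: index_mult_mat)
      moreover have "lower_triangular (B1 * \<Phi> 0)"
        by (rule lower_triangular_mult[OF B(2) \<Phi> B(3) \<Phi>0(1)])
      ultimately show ?thesis
        using ij B(2) \<Phi>[of 0] by (auto simp: lower_triangular_def upper_triangular_def)
    qed
    thus ?thesis using \<Phi>'[of 0] by (auto simp: lower_triangular_def upper_triangular_def)
  qed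
  from key obtain s where s: "s > 0" "\<And>w. w \<noteq> 0 \<Longrightarrow> norm w < s \<Longrightarrow>
      \<Phi>' w = eval_mat P (1 / w) * \<Phi> w * mat_diag L (d w)"
    by (auto simp: eventually_at)
  from exp obtain r where r: "r > 0" "\<And>\<tau>. \<tau> \<in> cov_inf X \<Longrightarrow> norm (1 / cov_proj X \<tau>) < r \<Longrightarrow>
      Y \<tau> = \<Phi> (1 / cov_proj X \<tau>) * mat_diag L (\<lambda>j. exp (\<epsilon> j * (- cov_log X \<tau>))) * C"
    by (auto simp: expansion_at_infinity_def)
  obtain r' where "open (cov_inf X)" and sub: "cov_inf X \<subseteq> cov_dom X"
    and "\<forall>z. r' < norm z \<longrightarrow> (\<exists>\<tau>\<in>cov_inf X. cov_proj X \<tau> = z)"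
    by (rule cov_inf_surjective[OF X u])
  let ?\<nu> = "\<lambda>j::nat. if j = 0 then int L - 1 else - 1"
  have "vcf_multiplier L f (cov_proj X \<tau>) * Y \<tau> = \<Phi>' (1 / cov_proj X \<tau>) *
      mat_diag L (\<lambda>j. exp ((\<epsilon> j + of_int (?\<nu> j)) * (- cov_log X \<tau>))) * C"
    if \<tau>: "\<tau> \<in> cov_inf X" "norm (1 / cov_proj X \<tau>) < min r s" for \<tau>
  proof -
    define w where "w = 1 / cov_proj X \<tau>"
    have z: "cov_proj X \<tau> \<noteq> 0" using cov_proj_nonzero[OF X] sub \<tau>(1) by blast
    have w: "w \<noteq> 0" "cov_proj X \<tau> = 1 / w" "norm w < s" using z \<tau>(2) by (auto simp: w_def)
    have exp_w: "exp (- cov_log X \<tau>) = w"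
      using X sub \<tau>(1) by (auto simp: w_def exp_minus inverse_eq_divide fuchsian_covering_def)
    define R where "R = eval_mat P (1 / w)"
    have Rc: "R \<in> carrier_mat L L" using P by (simp add: R_def)
    let ?E = "mat_diag L (\<lambda>j. exp (\<epsilon> j * (- cov_log X \<tau>)))"
    let ?E' = "mat_diag L (\<lambda>j. exp ((\<epsilon> j + of_int (?\<nu> j)) * (- cov_log X \<tau>)))"
    have "d w j * exp ((\<epsilon> j + of_int (?\<nu> j)) * (- cov_log X \<tau>)) = exp (\<epsilon> j * (- cov_log X \<tau>))" for j
    proof -
      have "exp ((\<epsilon> j + of_int (?\<nu> j)) * (- cov_log X \<tau>)) =
          exp (\<epsilon> j * (- cov_log X \<tau>)) * exp (of_int (?\<nu> j) * (- cov_log X \<tau>))"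
        by (simp only: distrib_right exp_add)
      also have "exp (of_int (?\<nu> j) * (- cov_log X \<tau>)) = w powi ?\<nu> j"
        unfolding exp_w[symmetric] by (rule exp_power_int[symmetric])
      finally have "d w j * exp ((\<epsilon> j + of_int (?\<nu> j)) * (- cov_log X \<tau>)) =
          exp (\<epsilon> j * (- cov_log X \<tau>)) * (d w j * w powi ?\<nu> j)"
        by (simp only: mult_ac)
      moreover have "d w j * w powi ?\<nu> j = 1"
        using w(1) by (auto simp: d_def simp flip: power_int_add)
      ultimately show ?thesis by simp
    qed
    hence E: "mat_diag L (d w) * ?E' = ?E" by simp
    have "vcf_multiplier L f (cov_proj X \<tau>) * Y \<tau> = R * (\<Phi> w * ?E * C)"
    proof -
      have "vcf_multiplier L f (cov_proj X \<tau>) = R"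
        unfolding R_def w(2) using w(1) by (intro RP) simp
      moreover have "Y \<tau> = \<Phi> w * ?E * C"
        unfolding w_def using \<tau> by (intro r(2)) auto
      ultimately show ?thesis by simp
    qed
    also have "\<dots> = R * \<Phi> w * ?E * C"
      using assoc_mult_mat[OF Rc mult_carrier_mat[OF \<Phi> mat_diag_dim] C(1)]
        assoc_mult_mat[OF Rc \<Phi> mat_diag_dim] by simp
    also have "R * \<Phi> w * ?E = R * \<Phi> w * mat_diag L (d w) * ?E'"
      unfolding E[symmetric] by (rule assoc_mult_mat[OF mult_carrier_mat[OF Rc \<Phi>] mat_diag_dim mat_diag_dim, symmetric])
    also have "R * \<Phi> w * mat_diag L (d w) = \<Phi>' w"
      unfolding R_def using s(2)[OF w(1,3)] by simp
    finally show ?thesis by (simp only: w_def)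
  qed
  hence "expansion_at_infinity L X (\<lambda>j. \<epsilon> j + of_int (?\<nu> j))
           (\<lambda>\<tau>. vcf_multiplier L f (cov_proj X \<tau>) * Y \<tau>) \<Phi>' C"
    unfolding expansion_at_infinity_def analytic_mat_at_0_def
    using \<Phi>' an' low' inv' C r(1) s(1) by (intro conjI allI impI exI[of _ "min r s"]) auto
  thus ?exp by blast
qed

section \<open>The transformed system is Fuchsian and its solution normalised\<close>

theorem mainTheorem7:
  fixes L N :: nat
    and u :: "nat \<Rightarrow> complex"
    and X :: covering
    and A :: "nat \<Rightarrow> complex mat"
    and \<epsilon>0 \<epsilon>inf :: "nat \<Rightarrow> complex"
    and Y \<Psi> \<Phi> :: "complex \<Rightarrow> complex mat"
    and C :: "complex mat"
    and f :: "nat \<Rightarrow> complex fps"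
  assumes "L \<ge> 2"
    and "fuchsian_covering N u X"
    and "normalized_solution L N u X A \<epsilon>0 \<epsilon>inf Y \<Psi> \<Phi> C"
    and "\<And>i. i < L \<Longrightarrow> f i = fps_expansion (\<lambda>w. \<Phi> w $$ (i, 0)) 0"
    and "\<And>k i. k < L \<Longrightarrow> i < L \<Longrightarrow> fps_nth (vcf L f k i) 0 \<noteq> 0"
  shows "(\<exists>P \<in> carrier_mat L L. \<forall>z. z \<noteq> 0 \<longrightarrow>
             vcf_multiplier L f z = map_mat (\<lambda>p. poly p z) P) \<and>
         schlesinger_multiplier L N u X \<epsilon>0 \<epsilon>inf Y
           (\<lambda>j. if j = 0 then int L - 1 else - 1) (vcf_multiplier L f)"
proof -
  note X = assms(2)
  let ?\<nu> = "\<lambda>j::nat. if j = 0 then int L - 1 else - 1"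
  let ?\<epsilon> = "\<lambda>j. \<epsilon>inf j + of_int (?\<nu> j)"
  let ?R = "vcf_multiplier L f"
  let ?Y = "\<lambda>\<tau>. ?R (cov_proj X \<tau>) * Y \<tau>"
  have L: "L > 0" using assms(1) by simp
  have sys: "fuchsian_system L N u A \<epsilon>0 \<epsilon>inf" and sol: "solves_system L N u X A Y"
    and exp0: "expansion_at_zero L X \<epsilon>0 Y \<Psi>" and expinf: "expansion_at_infinity L X \<epsilon>inf Y \<Phi> C"
    using assms(3) by (auto simp: normalized_solution_def)
  have sing: "singular_points N u" and u: "u (N + 1) = 0"
    and A: "\<And>k. k \<le> N + 1 \<Longrightarrow> A k \<in> carrier_mat L L"
    and A0: "upper_triangular (A (N + 1))" "nonresonant_exponents L (A (N + 1)) \<epsilon>0"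
    and nonres: "nonresonant_exponents L (residue_at_infinity L N A) \<epsilon>inf"
    using sys by (auto simp: fuchsian_system_def singular_points_def)
  obtain B0 B1 where B: "B0 \<in> carrier_mat L L" "B1 \<in> carrier_mat L L"
    and B0: "upper_triangular B0" "\<forall>i<L. B0 $$ (i, i) = 1" and B1: "lower_triangular B1"
    and R: "\<forall>z. z \<noteq> 0 \<longrightarrow> ?R z = B0 + z \<cdot>\<^sub>m B1"
    using vcf_multiplier_affine[OF L, of f] by metis
  define P where "P = mat L L (\<lambda>(i, j). [:B0 $$ (i, j), B1 $$ (i, j):])"
  have P: "P \<in> carrier_mat L L" by (simp add: P_def)
  have RP: "?R z = eval_mat P z" if "z \<noteq> 0" for z
    using R that B by (intro eq_matI) (auto simp: P_def)
  have P0: "eval_mat P 0 = B0"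
    using B by (intro eq_matI) (auto simp: P_def)
  have det_B0: "Determinant.det B0 = 1"
    using B(1) B0 by (intro det_unitriangular) auto
  have det_P: "Determinant.det P = 1"
    unfolding P_def
    by (rule vcf_multiplier_shifts_expansion(1)[OF X u L expinf assms(4,5) B B1 det_B0 R[rule_format]])
  obtain \<Phi>' where expinf': "expansion_at_infinity L X ?\<epsilon> ?Y \<Phi>' C"
    using vcf_multiplier_shifts_expansion(2)[OF X u L expinf assms(4,5) B B1 det_B0 R[rule_format]]
    by blast
  define Q where "Q = adj_mat P"
  have Q: "Q \<in> carrier_mat L L" "P * Q = 1\<^sub>m L" "Q * P = 1\<^sub>m L"
    using adj_mat[OF P] det_P by (auto simp: Q_def)
  \<comment> \<open>The residue of \<open>R A R^-1\<close> at \<open>u k\<close>; the term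
    \<open>R' R^-1\<close> is polynomial and adds nothing to it.\<close>
  define A' where "A' k = eval_mat P (u k) * A k * eval_mat Q (u k)" for k
  have PQ: "eval_mat P z \<in> carrier_mat L L" "eval_mat Q z \<in> carrier_mat L L"
    "eval_mat P z * eval_mat Q z = 1\<^sub>m L" "eval_mat Q z * eval_mat P z = 1\<^sub>m L" for z
    using P Q(1) eval_mat_mult[OF P Q(1), of z] eval_mat_mult[OF Q(1) P, of z]
    by (auto simp: Q(2,3) eval_mat_one)
  have A'c: "A' k \<in> carrier_mat L L" if "k \<le> N + 1" for k
    unfolding A'_def by (rule mult_carrier_mat[OF mult_carrier_mat[OF PQ(1) A[OF that]] PQ(2)])
  have Y': "?Y \<tau> = eval_mat P (cov_proj X \<tau>) * Y \<tau>" if "\<tau> \<in> cov_dom X" for \<tau>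
    using RP cov_proj_nonzero[OF X that] by simp
  obtain G where sol': "solves_system L N u X A' ?Y"
    and G: "G \<in> carrier_mat L L" "\<Phi>' 0 * G = 1\<^sub>m L" "G * \<Phi>' 0 = 1\<^sub>m L"
    and res: "residue_at_infinity L N A' = \<Phi>' 0 * mat_diag L ?\<epsilon> * G"
    unfolding A'_def
    by (rule gauge_transformed_system[OF X u A P Q(1,3) sol Y' expinf'])
  have \<Phi>'0: "\<Phi>' 0 \<in> carrier_mat L L" "lower_triangular (\<Phi>' 0)"
    using expinf' by (auto simp: expansion_at_infinity_def analytic_mat_at_0_def)
  have low: "lower_triangular (residue_at_infinity L N A')"
    unfolding res
  proof (intro lower_triangular_mult[OF mult_carrier_mat[OF \<Phi>'0(1) mat_diag_dim] G(1)]
      lower_triangular_mult[OF \<Phi>'0(1) mat_diag_dim \<Phi>'0(2)])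
    show "lower_triangular (mat_diag L ?\<epsilon>)"
      by (auto simp: mat_diag_def lower_triangular_def upper_triangular_def)
    show "lower_triangular G"
      by (rule lower_triangular_inverse[OF \<Phi>'0(1) G(1) \<Phi>'0(2) G(2)])
  qed
  have "spectrum (residue_at_infinity L N A') = ?\<epsilon> ` {..<L}"
  proof -
    have "similar_mat (residue_at_infinity L N A') (mat_diag L ?\<epsilon>)"
      unfolding res by (rule similar_mat_conjugate[OF \<Phi>'0(1) G(1) mat_diag_dim G(2,3)])
    moreover have "residue_at_infinity L N A' \<in> carrier_mat L L"
      by (simp add: residue_at_infinity_def)
    ultimately show ?thesis
      using spectrum_similar[OF _ mat_diag_dim] spectrum_mat_diag by metis
  qed
  \<comment> \<open>The shifts are integers, so an integer difference of new exponents would give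
    one of old exponents.\<close>
  moreover have "?\<epsilon> j - ?\<epsilon> k \<notin> \<int>" if "j < L" "k < L" "j \<noteq> k" for j k
  proof
    assume "?\<epsilon> j - ?\<epsilon> k \<in> \<int>"
    hence "?\<epsilon> j - ?\<epsilon> k - of_int (?\<nu> j - ?\<nu> k) \<in> \<int>"
      by (rule Ints_diff) (rule Ints_of_int)
    moreover have "?\<epsilon> j - ?\<epsilon> k - of_int (?\<nu> j - ?\<nu> k) = \<epsilon>inf j - \<epsilon>inf k"
      by simp
    ultimately show False using nonres that by (simp add: nonresonant_exponents_def)
  qed
  ultimately have nonres': "nonresonant_exponents L (residue_at_infinity L N A') ?\<epsilon>"
    unfolding nonresonant_exponents_def by blast
  have A'0: "A' (N + 1) = B0 * A (N + 1) * eval_mat Q 0"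
    by (simp only: A'_def u P0)
  have "upper_triangular (eval_mat Q 0)"
    using upper_triangular_inverse[OF B(1) PQ(2) B0(1)] PQ(4)[of 0] P0 by simp
  hence up: "upper_triangular (A' (N + 1))"
    unfolding A'0 using B(1) A[of "N + 1"] PQ(2) B0(1) A0(1)
    by (intro upper_triangular_mult[of _ L]) auto
  have "similar_mat (A' (N + 1)) (A (N + 1))"
    unfolding A'_def by (rule similar_mat_conjugate[OF PQ(1,2) A PQ(3,4)]) simp
  hence "spectrum (A' (N + 1)) = spectrum (A (N + 1))"
    by (intro spectrum_similar[OF A'c A]) auto
  hence "nonresonant_exponents L (A' (N + 1)) \<epsilon>0"
    using A0(2) by (simp add: nonresonant_exponents_def)
  hence sys': "fuchsian_system L N u A' \<epsilon>0 ?\<epsilon>"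
    using sing A'c up low nonres' by (simp add: fuchsian_system_def)
  define \<Psi>' where "\<Psi>' z = eval_mat P z * \<Psi> z" for z
  have "expansion_at_zero L X \<epsilon>0 ?Y \<Psi>'"
  proof -
    have \<Psi>: "\<And>z. \<Psi> z \<in> carrier_mat L L"
      "\<And>i j. i < L \<Longrightarrow> j < L \<Longrightarrow> (\<lambda>z. \<Psi> z $$ (i, j)) analytic_on {0}"
      "upper_triangular (\<Psi> 0)" "\<And>j. j < L \<Longrightarrow> \<Psi> 0 $$ (j, j) = 1"
      using exp0 by (auto simp: expansion_at_zero_def analytic_mat_at_0_def)
    from exp0 obtain r where r: "r > 0" "\<And>\<tau>. \<tau> \<in> cov_zero X \<Longrightarrow> norm (cov_proj X \<tau>) < r \<Longrightarrow>
        Y \<tau> = \<Psi> (cov_proj X \<tau>) * mat_diag L (\<lambda>j. exp (\<epsilon>0 j * cov_log X \<tau>))"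
      by (auto simp: expansion_at_zero_def)
    have sub: "cov_zero X \<subseteq> cov_dom X"
      using X in_components_subset by (fastforce simp: fuchsian_covering_def)
    have "(\<lambda>z. \<Psi>' z $$ (i, j)) analytic_on {0}" if ij: "i < L" "j < L" for i j
    proof -
      have "\<Psi>' z $$ (i, j) = (\<Sum>k<L. poly (P $$ (i, k)) z * \<Psi> z $$ (k, j))" for z
        unfolding \<Psi>'_def index_mult_mat_sum[OF PQ(1) \<Psi>(1) ij] using P ij by simp
      moreover have "(\<lambda>z. \<Sum>k<L. poly (P $$ (i, k)) z * \<Psi> z $$ (k, j)) analytic_on {0}"
        using ij by (intro analytic_intros \<Psi>(2))
          (auto simp: analytic_at intro!: exI[of _ UNIV] holomorphic_intros)
      ultimately show ?thesis by simp
    qed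
    moreover have "\<Psi>' 0 = B0 * \<Psi> 0" by (simp only: \<Psi>'_def P0)
    moreover have "upper_triangular (B0 * \<Psi> 0)"
      by (rule upper_triangular_mult[OF B(1) \<Psi>(1) B0(1) \<Psi>(3)])
    moreover have "(B0 * \<Psi> 0) $$ (j, j) = 1" if "j < L" for j
      using upper_triangular_mult_diag[OF B(1) \<Psi>(1) B0(1) \<Psi>(3) that] B0(2) \<Psi>(4) that by simp
    moreover have "?Y \<tau> = \<Psi>' (cov_proj X \<tau>) * mat_diag L (\<lambda>j. exp (\<epsilon>0 j * cov_log X \<tau>))"
      if "\<tau> \<in> cov_zero X" "norm (cov_proj X \<tau>) < r" for \<tau>
      using Y'[of \<tau>] sub that r(2)[OF that] assoc_mult_mat[OF PQ(1) \<Psi>(1) mat_diag_dim]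
      by (auto simp: \<Psi>'_def)
    ultimately show ?thesis
      using r(1) mult_carrier_mat[OF PQ(1) \<Psi>(1)]
      unfolding expansion_at_zero_def analytic_mat_at_0_def by (auto simp: \<Psi>'_def simp del: index_mult_mat)
  qed
  hence "normalized_solution L N u X A' \<epsilon>0 ?\<epsilon> ?Y \<Psi>' \<Phi>' C"
    using sys' sol' expinf' by (simp add: normalized_solution_def)
  moreover have "rational_matrix L ?R"
    unfolding rational_matrix_def
  proof (intro conjI allI impI)
    fix z show "?R z \<in> carrier_mat L L" by (simp add: vcf_multiplier_def)
  next
    fix i j assume "i < L" "j < L"
    \<comment> \<open>The denominator \<open>z\<close>, compensated in the numerator, excludes the
      one point where the multiplier may differ from \<open>P\<close>.\<close>
    hence "\<forall>z. poly [:0, 1:] z \<noteq> 0 \<longrightarrow>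
        ?R z $$ (i, j) = poly ([:0, 1:] * P $$ (i, j)) z / poly [:0, 1:] z"
      using RP P by auto
    thus "\<exists>p q. q \<noteq> 0 \<and> (\<forall>z. poly q z \<noteq> 0 \<longrightarrow> ?R z $$ (i, j) = poly p z / poly q z)"
      by (intro exI[of _ "[:0, 1:] * P $$ (i, j)"] exI[of _ "[:0, 1:]"]) auto
  qed
  ultimately have "schlesinger_multiplier L N u X \<epsilon>0 \<epsilon>inf Y ?\<nu> ?R"
    unfolding schlesinger_multiplier_def by blast
  thus ?thesis using P RP by blast
qed

end
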